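(* Let $\Sigma=\{0,1\}$ be the two-element discrete commutable set. Let $X$ be a set whose elements are effectively encoded by natural numbers, and suppose there are a map $h:X\to\mathcal{L}\ddot\Sigma$ and a computable map $l':\mathcal{T}\ddot\Sigma\to X$ (terms being given by syntax trees) such that $h\circ l' = l$, where $l:\mathcal{T}\ddot\Sigma\to\mathcal{L}\ddot\Sigma$ is the language interpretation. Then equality on $X$ is undecidable, i.e. there is no algorithm that decides, given codes of two elements of $X$, whether they encode the same element. In particular, equality is undecidable in $\mathcal{T}\ddot\Sigma$, in $\mathcal{K}\ddot\Sigma$ and in $\mathcal{L}\ddot\Sigma$ (elements being presented by terms).
   Context: A pre-Kleene algebra is a set with constants $0,1$, binary operations $+,\cdot$ and a unary operation ${}^*$ such that $(+,0)$ is a commutative idempotent monoid, $(\cdot,1)$ is a monoid, $\cdot$ distributes over $+$ on both sides, $0\cdot x=x\cdot 0=0$, and $x^*=1+x\cdot x^*$ for all $x$. Its order is $x\le y$ iff $x+y=y$. A Kleene algebra is a pre-Kleene algebra additionally satisfying $xy\le y\Rightarrow x^*y\le y$ and $xy\le x\Rightarrow xy^*\le x$. A commutable set is a set $Y$ with a reflexive symmetric relation $\sim$; it is discrete if $\sim$ is equality. $\mathcal{S}Y$ is the monoid of strings over $Y$ modulo the congruence generated by $xy=yx$ for $x\sim y$. $\mathcal{T}Y$ (resp. $\mathcal{K}Y$) is the pre-Kleene algebra (resp. Kleene algebra) freely generated by $Y$ subject to the equations $xy=yx$ for $x\sim y$, i.e. terms over $Y$ modulo the corresponding axioms and these equations.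 The power set of $\mathcal{S}Y$ is a Kleene algebra under $\emptyset,\{1\},\cup$, elementwise concatenation and $A^*=\bigcup_n A^n$; $\mathcal{L}Y$ is its smallest subalgebra containing all singletons, and the language interpretation $l:\mathcal{T}Y\to\mathcal{L}Y$ is the unique morphism with $l(y)=\{y\}$ for $y\in Y$. For commutable sets $Y,Z$, $Y\oplus Z$ is the disjoint union $\{y_l\mid y\in Y\}\cup\{z_r\mid z\in Z\}$ with $y_l\sim z_r$ always, $y_l\sim y'_l$ iff $y\sim y'$, $z_r\sim z'_r$ iff $z\sim z'$; and $\ddot Y=Y\oplus Y$. *)

theory Defs
  imports "HOL-Library.Set_Algebras" "HOL-Library.Nat_Bijection"
begin

section \<open>Kleene algebras\<close>

class pre_kleene_algebra = semiring_0 + monoid_mult +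
  fixes star :: "'a \<Rightarrow> 'a"
  assumes add_idem: "x + x = x"
    and star_unfold: "star x = 1 + x * star x"

abbreviation (in plus) ka_le :: "'a \<Rightarrow> 'a \<Rightarrow> bool"
  where "ka_le x y \<equiv> x + y = y"

class kleene_algebra = pre_kleene_algebra +
  assumes star_induct_left: "ka_le (x * y) y \<Longrightarrow> ka_le (star x * y) y"
    and star_induct_right: "ka_le (x * y) x \<Longrightarrow> ka_le (x * star y) x"

definition ka_hom :: "('a::pre_kleene_algebra \<Rightarrow> 'b::pre_kleene_algebra) \<Rightarrow> bool"
  where "ka_hom f \<longleftrightarrow> f 0 = 0 \<and> f 1 = 1 \<and> (\<forall>x y. f (x + y) = f x + f y)
    \<and> (\<forall>x y. f (x * y) = f x * f y) \<and> (\<forall>x. f (star x) = star (f x))"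


section \<open>Commutable sets\<close>

text \<open>
  A commutable set is rendered as a type of class \<open>commutable\<close>; the sum \<open>Y \<oplus> Z\<close> is the
  sum type, so that \<open>Y \<oplus> Y\<close> is \<open>'y + 'y\<close>.
\<close>

class commutable =
  fixes comm :: "'a \<Rightarrow> 'a \<Rightarrow> bool"
  assumes comm_refl: "comm x x"
    and comm_sym: "comm x y \<Longrightarrow> comm y x"

instantiation sum :: (commutable, commutable) commutable
begin

fun comm_sum :: "'a + 'b \<Rightarrow> 'a + 'b \<Rightarrow> bool" where
  "comm_sum (Inl y) (Inl y') \<longleftrightarrow> comm y y'"
| "comm_sum (Inr z) (Inr z') \<longleftrightarrow> comm z z'"
| "comm_sum (Inl y) (Inr z) \<longleftrightarrow> True"
| "comm_sum (Inr z) (Inl y) \<longleftrightarrow> True"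

instance
proof
  fix x y :: "'a + 'b"
  show "comm x x" by (cases x) (auto intro: comm_refl)
  show "comm x y \<Longrightarrow> comm y x" by (cases x; cases y) (auto intro: comm_sym)
qed

end

datatype sigma = Sigma0 | Sigma1

instantiation sigma :: commutable
begin

definition comm_sigma :: "sigma \<Rightarrow> sigma \<Rightarrow> bool"
  where "comm_sigma x y \<longleftrightarrow> x = y"

instance by standard (auto simp: comm_sigma_def)

end


section \<open>The monoid of strings modulo commutation\<close>

inductive str_eq :: "'y::commutable list \<Rightarrow> 'y list \<Rightarrow> bool" where
  str_swap: "comm x y \<Longrightarrow> str_eq [x, y] [y, x]"
| str_refl: "str_eq u u"
| str_sym: "str_eq u v \<Longrightarrow> str_eq v u"
| str_trans: "str_eq u v \<Longrightarrow> str_eq v w \<Longrightarrow> str_eq u w"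
| str_append: "str_eq u u' \<Longrightarrow> str_eq v v' \<Longrightarrow> str_eq (u @ v) (u' @ v')"

quotient_type (overloaded) 'y strings = "'y::commutable list" / str_eq
  by (intro equivpI reflpI sympI transpI) (blast intro: str_eq.intros)+

instantiation strings :: (commutable) monoid_mult
begin

lift_definition one_strings :: "'a strings" is "[]" .

lift_definition times_strings :: "'a strings \<Rightarrow> 'a strings \<Rightarrow> 'a strings" is append
  by (rule str_append)

instance by standard (transfer; simp add: str_refl)+

end

lift_definition letter :: "'y::commutable \<Rightarrow> 'y strings" is "\<lambda>y. [y]" .


section \<open>Free algebras\<close>

datatype 'y trm =
    Zero | One | Gen 'y | Plus "'y trm" "'y trm" | Times "'y trm" "'y trm" | Star "'y trm"

inductive pka_eq :: "'y::commutable trm \<Rightarrow> 'y trm \<Rightarrow> bool" where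
  pka_comm: "comm x y \<Longrightarrow> pka_eq (Times (Gen x) (Gen y)) (Times (Gen y) (Gen x))"
| pka_add_assoc: "pka_eq (Plus (Plus r s) t) (Plus r (Plus s t))"
| pka_add_commute: "pka_eq (Plus s t) (Plus t s)"
| pka_add_zero: "pka_eq (Plus Zero t) t"
| pka_add_idem: "pka_eq (Plus t t) t"
| pka_mult_assoc: "pka_eq (Times (Times r s) t) (Times r (Times s t))"
| pka_one_mult: "pka_eq (Times One t) t"
| pka_mult_one: "pka_eq (Times t One) t"
| pka_distrib_right: "pka_eq (Times (Plus r s) t) (Plus (Times r t) (Times s t))"
| pka_distrib_left: "pka_eq (Times r (Plus s t)) (Plus (Times r s) (Times r t))"
| pka_zero_mult: "pka_eq (Times Zero t) Zero"
| pka_mult_zero: "pka_eq (Times t Zero) Zero"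
| pka_star: "pka_eq (Star t) (Plus One (Times t (Star t)))"
| pka_refl: "pka_eq t t"
| pka_sym: "pka_eq s t \<Longrightarrow> pka_eq t s"
| pka_trans: "pka_eq r s \<Longrightarrow> pka_eq s t \<Longrightarrow> pka_eq r t"
| pka_cong_plus: "pka_eq s s' \<Longrightarrow> pka_eq t t' \<Longrightarrow> pka_eq (Plus s t) (Plus s' t')"
| pka_cong_times: "pka_eq s s' \<Longrightarrow> pka_eq t t' \<Longrightarrow> pka_eq (Times s t) (Times s' t')"
| pka_cong_star: "pka_eq t t' \<Longrightarrow> pka_eq (Star t) (Star t')"

inductive ka_eq :: "'y::commutable trm \<Rightarrow> 'y trm \<Rightarrow> bool" where
  ka_pka: "pka_eq s t \<Longrightarrow> ka_eq s t"
| ka_induct_left: "ka_eq (Plus (Times s t) t) t \<Longrightarrow> ka_eq (Plus (Times (Star s) t) t) t"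
| ka_induct_right: "ka_eq (Plus (Times s t) s) s \<Longrightarrow> ka_eq (Plus (Times s (Star t)) s) s"
| ka_sym: "ka_eq s t \<Longrightarrow> ka_eq t s"
| ka_trans: "ka_eq r s \<Longrightarrow> ka_eq s t \<Longrightarrow> ka_eq r t"
| ka_cong_plus: "ka_eq s s' \<Longrightarrow> ka_eq t t' \<Longrightarrow> ka_eq (Plus s t) (Plus s' t')"
| ka_cong_times: "ka_eq s s' \<Longrightarrow> ka_eq t t' \<Longrightarrow> ka_eq (Times s t) (Times s' t')"
| ka_cong_star: "ka_eq t t' \<Longrightarrow> ka_eq (Star t) (Star t')"

text \<open>\<open>'y free_pka\<close> is \<open>\<T>Y\<close> and \<open>'y free_ka\<close> is \<open>\<K>Y\<close>.\<close>

quotient_type (overloaded) 'y free_pka = "'y::commutable trm" / pka_eq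
  morphisms rep_pka pka_of
  by (intro equivpI reflpI sympI transpI) (blast intro: pka_refl pka_sym pka_trans)+

quotient_type (overloaded) 'y free_ka = "'y::commutable trm" / ka_eq
  morphisms rep_ka ka_of
  by (intro equivpI reflpI sympI transpI) (blast intro: pka_refl ka_pka ka_sym ka_trans)+

instantiation free_pka :: (commutable) pre_kleene_algebra
begin

lift_definition zero_free_pka :: "'a free_pka" is Zero .
lift_definition one_free_pka :: "'a free_pka" is One .
lift_definition plus_free_pka :: "'a free_pka \<Rightarrow> 'a free_pka \<Rightarrow> 'a free_pka" is Plus
  by (rule pka_cong_plus)
lift_definition times_free_pka :: "'a free_pka \<Rightarrow> 'a free_pka \<Rightarrow> 'a free_pka" is Times
  by (rule pka_cong_times)
lift_definition star_free_pka :: "'a free_pka \<Rightarrow> 'a free_pka" is Star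
  by (rule pka_cong_star)

instance by standard (transfer; rule pka_eq.intros)+

end

instantiation free_ka :: (commutable) kleene_algebra
begin

lift_definition zero_free_ka :: "'a free_ka" is Zero .
lift_definition one_free_ka :: "'a free_ka" is One .
lift_definition plus_free_ka :: "'a free_ka \<Rightarrow> 'a free_ka \<Rightarrow> 'a free_ka" is Plus
  by (rule ka_cong_plus)
lift_definition times_free_ka :: "'a free_ka \<Rightarrow> 'a free_ka \<Rightarrow> 'a free_ka" is Times
  by (rule ka_cong_times)
lift_definition star_free_ka :: "'a free_ka \<Rightarrow> 'a free_ka" is Star
  by (rule ka_cong_star)

instance
proof
  fix x y :: "'a free_ka"
  show "x * y + y = y \<Longrightarrow> star x * y + y = y" by transfer (rule ka_induct_left)
  show "x * y + x = x \<Longrightarrow> x * star y + x = x" by transfer (rule ka_induct_right)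
qed (transfer, rule ka_pka, rule pka_eq.intros)+

end


section \<open>Languages\<close>

text \<open>
  Products, unit and powers of sets of strings are the elementwise ones of
  \<open>Set_Algebras\<close>. The addition of that theory (elementwise sum) plays no role; the sum of
  languages is their union.
\<close>

definition lang_star :: "'a::monoid_mult set \<Rightarrow> 'a set"
  where "lang_star A = (\<Union>n. A ^ n)"

inductive_set regular :: "'y::commutable strings set set" where
  regular_singleton: "{w} \<in> regular"
| regular_zero: "{} \<in> regular"
| regular_one: "{1} \<in> regular"
| regular_plus: "A \<in> regular \<Longrightarrow> B \<in> regular \<Longrightarrow> A \<union> B \<in> regular"
| regular_times: "A \<in> regular \<Longrightarrow> B \<in> regular \<Longrightarrow> A * B \<in> regular"
| regular_star: "A \<in> regular \<Longrightarrow> lang_star A \<in> regular"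

text \<open>\<open>'y lang\<close> is \<open>\<L>Y\<close>.\<close>

typedef (overloaded) 'y lang = "regular :: 'y::commutable strings set set"
  morphisms strings_of Lang
  using regular_zero by blast

setup_lifting type_definition_lang

lemma set_times_Un_left: "(A \<union> B) * C = A * C \<union> B * (C :: 'a::times set)"
  by (auto simp: set_times_def)

lemma set_times_Un_right: "C * (A \<union> B) = C * A \<union> C * (B :: 'a::times set)"
  by (auto simp: set_times_def)

lemma set_times_empty: "{} * A = {}" "A * {} = ({} :: 'a::times set)"
  by (auto simp: set_times_def)

lemma lang_star_unfold: "lang_star A = {1} \<union> A * lang_star A"
proof -
  have "(UNIV :: nat set) = insert 0 (range Suc)"
    using not0_implies_Suc by blast
  then have "lang_star A = A ^ 0 \<union> (\<Union>n. A ^ Suc n)"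
    unfolding lang_star_def by (metis UN_insert image_image)
  also have "(\<Union>n. A ^ Suc n) = A * lang_star A"
    by (auto simp: lang_star_def set_times_def)
  finally show ?thesis by simp
qed

lemma lang_star_induct_left:
  assumes "A * B \<subseteq> B" shows "lang_star A * B \<subseteq> B"
proof -
  have "A ^ n * B \<subseteq> B" for n
  proof (induction n)
    case (Suc n)
    have "A ^ Suc n * B = A * (A ^ n * B)" by (simp add: mult.assoc)
    also have "\<dots> \<subseteq> A * B" using Suc by (intro set_times_mono2) auto
    finally show ?case using assms by blast
  qed (simp del: set_one)
  then show ?thesis by (fastforce simp: lang_star_def set_times_def)
qed

lemma lang_star_induct_right:
  assumes "A * B \<subseteq> A" shows "A * lang_star B \<subseteq> A"
proof -
  have "A * B ^ n \<subseteq> A" for n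
  proof (induction n)
    case (Suc n)
    have "A * B ^ Suc n = (A * B) * B ^ n" by (simp add: mult.assoc)
    also have "\<dots> \<subseteq> A * B ^ n" using assms by (intro set_times_mono2) auto
    finally show ?case using Suc by blast
  qed (simp del: set_one)
  then show ?thesis by (fastforce simp: lang_star_def set_times_def)
qed

instantiation lang :: (commutable) kleene_algebra
begin

lift_definition zero_lang :: "'a lang" is "{}" by (rule regular_zero)
lift_definition one_lang :: "'a lang" is "{1}" by (rule regular_one)
lift_definition plus_lang :: "'a lang \<Rightarrow> 'a lang \<Rightarrow> 'a lang" is "(\<union>)" by (rule regular_plus)
lift_definition times_lang :: "'a lang \<Rightarrow> 'a lang \<Rightarrow> 'a lang" is "(*)" by (rule regular_times)
lift_definition star_lang :: "'a lang \<Rightarrow> 'a lang" is lang_star by (rule regular_star)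

instance
proof
  fix x y z :: "'a lang"
  show "x + y + z = x + (y + z)" by transfer auto
  show "x + y = y + x" by transfer auto
  show "0 + x = x" by transfer auto
  show "x * y * z = x * (y * z)" by transfer (rule mult.assoc)
  show "1 * x = x" by transfer (simp add: set_one[symmetric] del: set_one)
  show "x * 1 = x" by transfer (simp add: set_one[symmetric] del: set_one)
  show "(x + y) * z = x * z + y * z" by transfer (rule set_times_Un_left)
  show "x * (y + z) = x * y + x * z" by transfer (rule set_times_Un_right)
  show "0 * x = 0" by transfer (rule set_times_empty)
  show "x * 0 = 0" by transfer (rule set_times_empty)
  show "x + x = x" by transfer auto
  show "star x = 1 + x * star x" by transfer (rule lang_star_unfold)
  show "x * y + y = y \<Longrightarrow> star x * y + y = y"
    by transfer (simp add: subset_Un_eq[symmetric] lang_star_induct_left)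
  show "x * y + x = x \<Longrightarrow> x * star y + x = x"
    by transfer (simp add: subset_Un_eq[symmetric] lang_star_induct_right)
qed

end

lift_definition lang_letter :: "'y::commutable \<Rightarrow> 'y lang" is "\<lambda>y. {letter y}"
  by (rule regular_singleton)

primrec trm_lang :: "'y::commutable trm \<Rightarrow> 'y lang" where
  "trm_lang Zero = 0"
| "trm_lang One = 1"
| "trm_lang (Gen y) = lang_letter y"
| "trm_lang (Plus s t) = trm_lang s + trm_lang t"
| "trm_lang (Times s t) = trm_lang s * trm_lang t"
| "trm_lang (Star t) = star (trm_lang t)"

lemma lang_letter_commute:
  assumes "comm x y"
  shows "lang_letter x * lang_letter y = lang_letter y * lang_letter x"
proof -
  have "letter x * letter y = letter y * letter x"
    using assms by transfer (simp add: str_swap)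
  then show ?thesis by transfer (simp add: set_times_def)
qed

lemma trm_lang_pka_eq: "pka_eq s t \<Longrightarrow> trm_lang s = trm_lang t"
proof (induction rule: pka_eq.induct)
  case (pka_comm x y)
  then show ?case by (simp, intro lang_letter_commute)
next
  case (pka_add_commute s t)
  show ?case by (simp add: add.commute)
next
  case (pka_star t)
  show ?case using star_unfold[of "trm_lang t"] by simp
qed (simp_all add: add.assoc mult.assoc distrib_left distrib_right add_idem)

lift_definition lang_interp :: "'y::commutable free_pka \<Rightarrow> 'y lang" is trm_lang
  by (rule trm_lang_pka_eq)

lemma lang_interp_unique_hom:
  "ka_hom f \<and> (\<forall>y. f (pka_of (Gen y)) = lang_letter y) \<longleftrightarrow> f = lang_interp"
proof
  assume f: "ka_hom f \<and> (\<forall>y. f (pka_of (Gen y)) = lang_letter y)"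
  have "f (pka_of t) = trm_lang t" for t
    using f by (induction t) (simp_all add: ka_hom_def zero_free_pka.abs_eq[symmetric]
      one_free_pka.abs_eq[symmetric] plus_free_pka.abs_eq[symmetric]
      times_free_pka.abs_eq[symmetric] star_free_pka.abs_eq[symmetric])
  then show "f = lang_interp"
    by (intro ext, rule_tac x = x in free_pka.abs_induct) (simp add: lang_interp.abs_eq)
next
  have "ka_hom (lang_interp :: 'a free_pka \<Rightarrow> 'a lang)"
    unfolding ka_hom_def by (intro conjI allI; transfer; simp)
  then show "f = lang_interp \<Longrightarrow> ka_hom f \<and> (\<forall>y. f (pka_of (Gen y)) = lang_letter y)"
    by (simp add: lang_interp.abs_eq)
qed


section \<open>Computability\<close>

text \<open>
  Programs for the partial recursive functions. Arities are not tracked: a program that is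
  run on a list of unsuitable length either ignores the extra arguments or has no value.
\<close>

datatype recf = RZero | RSuc | RProj nat | RComp recf "recf list" | RPrim recf recf | RMin recf

inductive rec_eval :: "recf \<Rightarrow> nat list \<Rightarrow> nat \<Rightarrow> bool" where
  rec_zero: "rec_eval RZero xs 0"
| rec_suc: "rec_eval RSuc (x # xs) (Suc x)"
| rec_proj: "i < length xs \<Longrightarrow> rec_eval (RProj i) xs (xs ! i)"
| rec_comp: "list_all2 (\<lambda>g y. rec_eval g xs y) gs ys \<Longrightarrow> rec_eval f ys z
    \<Longrightarrow> rec_eval (RComp f gs) xs z"
| rec_prim_0: "rec_eval f xs z \<Longrightarrow> rec_eval (RPrim f g) (0 # xs) z"
| rec_prim_Suc: "rec_eval (RPrim f g) (n # xs) y \<Longrightarrow> rec_eval g (n # y # xs) z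
    \<Longrightarrow> rec_eval (RPrim f g) (Suc n # xs) z"
| rec_min: "rec_eval f (n # xs) 0 \<Longrightarrow> (\<forall>i<n. \<exists>y. rec_eval f (i # xs) (Suc y))
    \<Longrightarrow> rec_eval (RMin f) xs n"

inductive_cases rec_zeroE: "rec_eval RZero xs z"
inductive_cases rec_sucE: "rec_eval RSuc xs z"
inductive_cases rec_projE: "rec_eval (RProj i) xs z"
inductive_cases rec_compE: "rec_eval (RComp f gs) xs z"
inductive_cases rec_prim_0E: "rec_eval (RPrim f g) (0 # xs) z"
inductive_cases rec_prim_SucE: "rec_eval (RPrim f g) (Suc n # xs) z"
inductive_cases rec_minE: "rec_eval (RMin f) xs z"

lemma rec_eval_deterministic: "rec_eval p xs y \<Longrightarrow> rec_eval p xs z \<Longrightarrow> y = z"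
proof (induction arbitrary: z rule: rec_eval.induct)
  case (rec_comp xs gs ys f y)
  from rec_comp.prems obtain ys' where
    ys': "list_all2 (\<lambda>g y. rec_eval g xs y) gs ys'" "rec_eval f ys' z"
    by (rule rec_compE)
  have "ys = ys'"
    using rec_comp.IH(1) ys'(1) by (intro nth_equalityI) (auto simp: list_all2_conv_all_nth)
  then show ?case using rec_comp.IH(2) ys'(2) by blast
next
  case (rec_prim_Suc f g n xs y u)
  from rec_prim_Suc.prems obtain y' where
    "rec_eval (RPrim f g) (n # xs) y'" "rec_eval g (n # y' # xs) z"
    by (rule rec_prim_SucE)
  then show ?case using rec_prim_Suc.IH by blast
next
  case (rec_min f n xs)
  from rec_min.prems have z: "rec_eval f (z # xs) 0" "\<forall>i<z. \<exists>y. rec_eval f (i # xs) (Suc y)"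
    by (blast elim: rec_minE)+
  show ?case
  proof (rule linorder_cases[of n z])
    assume "n < z"
    then show ?thesis using z(2) rec_min.IH(1) by fastforce
  next
    assume "z < n"
    then show ?thesis using z(1) rec_min.IH(2) by fastforce
  qed
qed ((elim rec_zeroE rec_sucE rec_projE rec_prim_0E; simp; fail)+)

text \<open>
  An encoding of the elements of \<open>X\<close> by numbers is a partial map \<open>\<nu>\<close> with \<open>ran \<nu> = X\<close>,
  where \<open>\<nu> n = Some x\<close> means that \<open>n\<close> is a code of \<open>x\<close>. An element may have many codes, and
  a number need not be a code. Algorithms are only required to behave well on codes.
\<close>

definition computable_map :: "(nat \<rightharpoonup> 'a) \<Rightarrow> (nat \<rightharpoonup> 'b) \<Rightarrow> ('a \<Rightarrow> 'b) \<Rightarrow> bool"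
  where "computable_map \<mu> \<nu> f \<longleftrightarrow>
    (\<exists>p. \<forall>n x. \<mu> n = Some x \<longrightarrow> (\<exists>m. rec_eval p [n] m \<and> \<nu> m = Some (f x)))"

definition decidable_equality :: "(nat \<rightharpoonup> 'a) \<Rightarrow> bool"
  where "decidable_equality \<nu> \<longleftrightarrow>
    (\<exists>p. \<forall>m\<in>dom \<nu>. \<forall>n\<in>dom \<nu>. rec_eval p [m, n] (if \<nu> m = \<nu> n then 1 else 0))"


section \<open>Presentation by syntax trees\<close>

fun gen_code :: "sigma + sigma \<Rightarrow> nat" where
  "gen_code (Inl Sigma0) = 0"
| "gen_code (Inl Sigma1) = 1"
| "gen_code (Inr Sigma0) = 2"
| "gen_code (Inr Sigma1) = 3"

primrec trm_code :: "(sigma + sigma) trm \<Rightarrow> nat" where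
  "trm_code Zero = prod_encode (0, 0)"
| "trm_code One = prod_encode (1, 0)"
| "trm_code (Gen y) = prod_encode (2, gen_code y)"
| "trm_code (Plus s t) = prod_encode (3, prod_encode (trm_code s, trm_code t))"
| "trm_code (Times s t) = prod_encode (4, prod_encode (trm_code s, trm_code t))"
| "trm_code (Star t) = prod_encode (5, trm_code t)"

lemma inj_gen_code: "inj gen_code"
proof (rule injI)
  fix x y assume "gen_code x = gen_code y"
  then show "x = y" by (cases x rule: gen_code.cases; cases y rule: gen_code.cases) auto
qed

lemma inj_trm_code: "inj trm_code"
proof (rule injI)
  show "trm_code s = trm_code t \<Longrightarrow> s = t" for s t
  proof (induction s arbitrary: t)
    case Zero then show ?case by (cases t) auto
  next
    case One then show ?case by (cases t) auto
  next
    case (Gen y) then show ?case by (cases t) (auto dest: injD[OF inj_gen_code])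
  next
    case (Plus s1 s2) then show ?case by (cases t) auto
  next
    case (Times s1 s2) then show ?case by (cases t) auto
  next
    case (Star s) then show ?case by (cases t) auto
  qed
qed

definition trm_of_code :: "nat \<rightharpoonup> (sigma + sigma) trm"
  where "trm_of_code n = (if n \<in> range trm_code then Some (inv trm_code n) else None)"

lemma trm_of_code_eq_Some_iff: "trm_of_code n = Some t \<longleftrightarrow> n = trm_code t"
  by (auto simp: trm_of_code_def inv_f_f[OF inj_trm_code])

definition pka_coding :: "nat \<rightharpoonup> (sigma + sigma) free_pka"
  where "pka_coding n = map_option pka_of (trm_of_code n)"

definition ka_coding :: "nat \<rightharpoonup> (sigma + sigma) free_ka"
  where "ka_coding n = map_option ka_of (trm_of_code n)"

definition lang_coding :: "nat \<rightharpoonup> (sigma + sigma) lang"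
  where "lang_coding n = map_option (\<lambda>t. lang_interp (pka_of t)) (trm_of_code n)"

end

theory Submission
  imports Defs
begin

text \<open>
  A Post system works on a queue of bits: a rule \<open>(\<alpha>, \<beta>)\<close> removes \<open>\<alpha>\<close> at the front and appends
  \<open>\<beta>\<close> at the back. Write \<open>l\<close>, \<open>r\<close> for the two copies of the alphabet and let \<open>\<rho>\<close> be the sum of all
  \<open>\<alpha>\<^sub>r \<beta>\<^sub>l\<close>. In a word of \<open>u\<^sub>l \<rho>\<^sup>*\<close>, the right part lists what was removed from the queue and the left
  part what was ever put into it, so a correct run that ends with the queue \<open>v\<close> is a word whose left
  part is its right part followed by \<open>v\<close>. The term \<open>t\<close> collects the words in which the run went wrong
  (left and right part differ at some position) or ended with a queue that begins with 0.

  If the system is deterministic and gets stuck on a queue that begins with 0, finitely many unfoldings of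
  \<open>\<rho>\<^sup>*\<close> prove \<open>u\<^sub>l \<rho>\<^sup>* \<le> t\<close> already in the free pre-Kleene algebra. If it reaches a queue that begins with 1,
  this run is a word of \<open>u\<^sub>l \<rho>\<^sup>*\<close> outside \<open>t\<close>, so the inequality fails for languages. Every map \<open>l'\<close> as in
  the theorem lies between the two interpretations, hence a decision procedure for its values
  separates the two outcomes. Post systems simulate all recursive functions, so some system
  runs the decision procedure on its own inequality, the input being the code of its own
  \<open>\<rho>\<close>, and then does the opposite.
\<close>

section \<open>Pre-Kleene algebras\<close>

definition below :: "'a::pre_kleene_algebra \<Rightarrow> 'a \<Rightarrow> bool" (infix "\<sqsubseteq>" 50)
  where "x \<sqsubseteq> y \<longleftrightarrow> x + y = y"

lemma below_refl: "x \<sqsubseteq> x"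
  by (simp add: below_def add_idem)

lemma below_trans [trans]: "x \<sqsubseteq> y \<Longrightarrow> y \<sqsubseteq> z \<Longrightarrow> x \<sqsubseteq> z"
  unfolding below_def by (metis add.assoc)

lemma below_add1: "x \<sqsubseteq> x + y"
  by (simp add: below_def add.assoc[symmetric] add_idem)

lemma below_add2: "y \<sqsubseteq> x + y"
  using below_add1[of y x] by (simp add: add.commute)

lemma zero_below: "0 \<sqsubseteq> x"
  by (simp add: below_def)

lemma add_below: "x \<sqsubseteq> z \<Longrightarrow> y \<sqsubseteq> z \<Longrightarrow> x + y \<sqsubseteq> z"
  by (simp add: below_def add.assoc)

lemma mult_below_mono:
  assumes "x \<sqsubseteq> x'" and "y \<sqsubseteq> y'"
  shows "x * y \<sqsubseteq> x' * y'"
proof -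
  have "x * y \<sqsubseteq> x' * y"
    using assms(1) by (metis below_def distrib_right)
  also have "x' * y \<sqsubseteq> x' * y'"
    using assms(2) by (metis below_def distrib_left)
  finally show ?thesis .
qed

lemma one_below_star: "1 \<sqsubseteq> star x"
  using below_add1 star_unfold by metis

lemma mult_star_below_star: "y \<sqsubseteq> x \<Longrightarrow> y * star x \<sqsubseteq> star x"
  by (metis below_add2 below_refl below_trans mult_below_mono star_unfold)

lemma prod_list_below_star:
  "(\<And>y. y \<in> set ys \<Longrightarrow> y \<sqsubseteq> x) \<Longrightarrow> prod_list ys \<sqsubseteq> star x"
proof (induction ys)
  case Nil
  then show ?case by (simp add: one_below_star)
next
  case (Cons y ys)
  then have "y * prod_list ys \<sqsubseteq> y * star x"
    by (simp add: mult_below_mono below_refl)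
  also have "\<dots> \<sqsubseteq> star x"
    using Cons.prems by (simp add: mult_star_below_star)
  finally show ?case by simp
qed

section \<open>Post systems\<close>

definition clash :: "'a list \<Rightarrow> 'a list \<Rightarrow> bool"
  where "clash u v \<longleftrightarrow> (\<exists>w a b u' v'. u = w @ a # u' \<and> v = w @ b # v' \<and> a \<noteq> b)"

definition post_step :: "('a list \<times> 'a list) set \<Rightarrow> 'a list \<Rightarrow> 'a list \<Rightarrow> bool"
  where "post_step P u v \<longleftrightarrow> (\<exists>\<alpha> \<beta> w. (\<alpha>, \<beta>) \<in> P \<and> u = \<alpha> @ w \<and> v = w @ \<beta>)"

definition deterministic :: "('a list \<times> 'a list) set \<Rightarrow> bool"
  where "deterministic P \<longleftrightarrow>
    (\<forall>\<alpha> \<beta> \<alpha>' \<beta>'. (\<alpha>, \<beta>) \<in> P \<longrightarrow> (\<alpha>', \<beta>') \<in> P \<longrightarrow> (\<alpha>, \<beta>) = (\<alpha>', \<beta>') \<or> clash \<alpha> \<alpha>')"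

lemma clash_append: "clash u v \<Longrightarrow> clash (u @ x) (v @ y)"
  unfolding clash_def by fastforce

lemma clash_Cons_neq: "a \<noteq> b \<Longrightarrow> clash (a # u) (b # v)"
  unfolding clash_def by (intro exI[of _ "[]"]) auto

lemma clash_Cons: "clash u v \<Longrightarrow> clash (a # u) (a # v)"
  unfolding clash_def by (metis append_Cons)

lemma post_step_deterministic:
  assumes "deterministic P" and "post_step P u v" and "(\<alpha>, \<beta>) \<in> P"
  shows "clash \<alpha> u \<or> (\<exists>w. u = \<alpha> @ w \<and> v = w @ \<beta>)"
proof -
  obtain \<alpha>' \<beta>' w where *: "(\<alpha>', \<beta>') \<in> P" "u = \<alpha>' @ w" "v = w @ \<beta>'"
    using assms(2) unfolding post_step_def by blast
  then show ?thesis
    using assms(1,3) clash_append[of \<alpha> \<alpha>' "[]" w] unfolding deterministic_def by fastforce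
qed

section \<open>Halting runs in the free pre-Kleene algebra\<close>

fun sigma_of :: "bool \<Rightarrow> sigma" where
  "sigma_of False = Sigma0"
| "sigma_of True = Sigma1"

definition lgen :: "bool \<Rightarrow> (sigma + sigma) trm"
  where "lgen b = Gen (Inl (sigma_of b))"

definition rgen :: "bool \<Rightarrow> (sigma + sigma) trm"
  where "rgen b = Gen (Inr (sigma_of b))"

fun word :: "('b \<Rightarrow> 'y trm) \<Rightarrow> 'b list \<Rightarrow> 'y trm" where
  "word g [] = One"
| "word g (b # bs) = Times (g b) (word g bs)"

fun rules_trm :: "(bool list \<times> bool list) list \<Rightarrow> (sigma + sigma) trm" where
  "rules_trm [] = Zero"
| "rules_trm ((\<alpha>, \<beta>) # P) = Plus (Times (word rgen \<alpha>) (word lgen \<beta>)) (rules_trm P)"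

definition match_trm :: "(sigma + sigma) trm"
  where "match_trm = Plus (Times (lgen False) (rgen False)) (Times (lgen True) (rgen True))"

definition clash_trm :: "(sigma + sigma) trm"
  where "clash_trm = Plus (Times (lgen False) (rgen True)) (Times (lgen True) (rgen False))"

definition any_trm :: "(bool \<Rightarrow> (sigma + sigma) trm) \<Rightarrow> (sigma + sigma) trm"
  where "any_trm g = Star (Plus (g False) (g True))"

definition run_trm :: "bool list \<Rightarrow> (sigma + sigma) trm \<Rightarrow> (sigma + sigma) trm"
  where "run_trm u \<rho> = Times (word lgen u) (Star \<rho>)"

definition harmless_trm :: "(sigma + sigma) trm \<Rightarrow> (sigma + sigma) trm"
  where "harmless_trm \<rho> = Plus (Times (Star match_trm) (Times (lgen False) (any_trm lgen)))
    (Times (Star match_trm) (Times clash_trm (Times (any_trm lgen) (Times (any_trm rgen) (Star \<rho>)))))"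

lemmas pka_of_simps = zero_free_pka.abs_eq[symmetric] one_free_pka.abs_eq[symmetric]
  plus_free_pka.abs_eq[symmetric] times_free_pka.abs_eq[symmetric]
  star_free_pka.abs_eq[symmetric]

lemma pka_of_word: "pka_of (word g u) = prod_list (map (\<lambda>b. pka_of (g b)) u)"
  by (induction u) (simp_all add: pka_of_simps)

lemma pka_of_word_append: "pka_of (word g (u @ v)) = pka_of (word g u) * pka_of (word g v)"
  by (simp add: pka_of_word)

lemma lgen_rgen_commute: "pka_of (lgen a) * pka_of (rgen b) = pka_of (rgen b) * pka_of (lgen a)"
  unfolding lgen_def rgen_def times_free_pka.abs_eq free_pka.abs_eq_iff
  by (rule pka_comm) simp

lemma lgen_rword_commute:
  "pka_of (lgen a) * pka_of (word rgen v) = pka_of (word rgen v) * pka_of (lgen a)"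
proof (induction v)
  case (Cons b v)
  have "pka_of (lgen a) * (pka_of (rgen b) * pka_of (word rgen v))
      = pka_of (rgen b) * (pka_of (lgen a) * pka_of (word rgen v))"
    by (simp add: mult.assoc[symmetric] lgen_rgen_commute)
  then show ?case by (simp add: pka_of_simps Cons mult.assoc)
qed (simp add: pka_of_simps)

lemma lword_rword_commute:
  "pka_of (word lgen u) * pka_of (word rgen v) = pka_of (word rgen v) * pka_of (word lgen u)"
proof (induction u)
  case (Cons a u)
  have "pka_of (lgen a) * (pka_of (word rgen v) * pka_of (word lgen u))
      = pka_of (word rgen v) * (pka_of (lgen a) * pka_of (word lgen u))"
    by (simp add: mult.assoc[symmetric] lgen_rword_commute)
  then show ?case by (simp add: pka_of_simps Cons mult.assoc)
qed (simp add: pka_of_simps)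

lemma lword_rword_append:
  "pka_of (word lgen (u @ u')) * pka_of (word rgen (v @ v'))
    = pka_of (word lgen u) * pka_of (word rgen v) * (pka_of (word lgen u') * pka_of (word rgen v'))"
proof -
  have "pka_of (word lgen u') * (pka_of (word rgen v) * pka_of (word rgen v'))
      = pka_of (word rgen v) * (pka_of (word lgen u') * pka_of (word rgen v'))"
    by (simp only: mult.assoc[symmetric] lword_rword_commute[of u' v])
  then show ?thesis by (simp add: pka_of_word_append mult.assoc)
qed

lemma word_below_any: "pka_of (word g u) \<sqsubseteq> pka_of (any_trm g)"
proof -
  have "pka_of (g b) \<sqsubseteq> pka_of (g False) + pka_of (g True)" for b
    by (cases b) (simp_all add: below_add1 below_add2)
  then show ?thesis
    unfolding any_trm_def pka_of_word star_free_pka.abs_eq[symmetric] plus_free_pka.abs_eq[symmetric]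
    by (intro prod_list_below_star) auto
qed

lemma match_absorb:
  "pka_of (word lgen w) * pka_of (word rgen w) * (pka_of (Star match_trm) * x)
    \<sqsubseteq> pka_of (Star match_trm) * x"
proof (induction w)
  case Nil
  then show ?case by (simp add: pka_of_simps below_refl)
next
  case (Cons a w)
  have "pka_of (lgen a) * pka_of (rgen a) \<sqsubseteq> pka_of match_trm"
    unfolding match_trm_def
    by (cases a) (simp_all add: plus_free_pka.abs_eq[symmetric] times_free_pka.abs_eq[symmetric]
        below_add1 below_add2)
  then have *: "pka_of (lgen a) * pka_of (rgen a) * pka_of (Star match_trm)
      \<sqsubseteq> pka_of (Star match_trm)"
    by (simp add: star_free_pka.abs_eq[symmetric] mult_star_below_star)
  have "pka_of (word lgen ([a] @ w)) * pka_of (word rgen ([a] @ w)) * (pka_of (Star match_trm) * x)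
      = pka_of (lgen a) * pka_of (rgen a)
        * (pka_of (word lgen w) * pka_of (word rgen w) * (pka_of (Star match_trm) * x))"
    unfolding lword_rword_append by (simp add: pka_of_simps mult.assoc)
  also have "\<dots> \<sqsubseteq> pka_of (lgen a) * pka_of (rgen a) * (pka_of (Star match_trm) * x)"
    by (intro mult_below_mono below_refl Cons)
  also have "\<dots> \<sqsubseteq> pka_of (Star match_trm) * x"
    using mult_below_mono[OF * below_refl] by (simp add: mult.assoc)
  finally show ?case by simp
qed

lemma match_absorb_harmless:
  "pka_of (word lgen w) * pka_of (word rgen w) * pka_of (harmless_trm \<rho>) \<sqsubseteq> pka_of (harmless_trm \<rho>)"
proof -
  let ?x = "pka_of (Times (lgen False) (any_trm lgen))
    + pka_of (Times clash_trm (Times (any_trm lgen) (Times (any_trm rgen) (Star \<rho>))))"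
  have "pka_of (harmless_trm \<rho>) = pka_of (Star match_trm) * ?x"
    by (simp add: harmless_trm_def plus_free_pka.abs_eq[symmetric] times_free_pka.abs_eq[symmetric]
        distrib_left)
  then show ?thesis using match_absorb by metis
qed

lemma stopped_below_harmless:
  assumes "u = False # u'"
  shows "pka_of (word lgen u) \<sqsubseteq> pka_of (harmless_trm \<rho>)"
proof -
  have "pka_of (word lgen u) = 1 * (pka_of (lgen False) * pka_of (word lgen u'))"
    by (simp add: assms times_free_pka.abs_eq[symmetric])
  also have "\<dots> \<sqsubseteq> pka_of (Star match_trm) * (pka_of (lgen False) * pka_of (any_trm lgen))"
    by (intro mult_below_mono below_refl word_below_any)
      (simp add: star_free_pka.abs_eq[symmetric] one_below_star)
  also have "\<dots> \<sqsubseteq> pka_of (harmless_trm \<rho>)"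
    unfolding harmless_trm_def times_free_pka.abs_eq plus_free_pka.abs_eq[symmetric]
    by (rule below_add1)
  finally show ?thesis .
qed

lemma clash_below_harmless:
  assumes "clash \<alpha> u"
  shows "pka_of (word lgen u) * (pka_of (word rgen \<alpha>) * pka_of (word lgen \<beta>) * pka_of (Star \<rho>))
    \<sqsubseteq> pka_of (harmless_trm \<rho>)"
proof -
  obtain w a b \<alpha>' u' where \<alpha>: "\<alpha> = w @ [a] @ \<alpha>'" and u: "u = w @ [b] @ u'" and ab: "a \<noteq> b"
    using assms unfolding clash_def by auto
  let ?l = "\<lambda>u. pka_of (word lgen u)" and ?r = "\<lambda>u. pka_of (word rgen u)"
  have c: "pka_of (lgen b) * pka_of (rgen a) \<sqsubseteq> pka_of clash_trm"
    using ab unfolding clash_trm_def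
    by (cases a; cases b) (simp_all add: plus_free_pka.abs_eq[symmetric]
        times_free_pka.abs_eq[symmetric] below_add1 below_add2)
  have "?l u * (?r \<alpha> * ?l \<beta> * pka_of (Star \<rho>)) = ?l u * ?r \<alpha> * (?l \<beta> * pka_of (Star \<rho>))"
    by (simp add: mult.assoc)
  also have "?l u * ?r \<alpha> = ?l w * ?r w * (?l [b] * ?r [a] * (?l u' * ?r \<alpha>'))"
    unfolding \<alpha> u lword_rword_append ..
  also have "?l w * ?r w * (?l [b] * ?r [a] * (?l u' * ?r \<alpha>')) * (?l \<beta> * pka_of (Star \<rho>))
      = ?l w * ?r w * (1 * (pka_of (lgen b) * pka_of (rgen a) * (?l u' * (?r \<alpha>' * ?l \<beta>) * pka_of (Star \<rho>))))"
    by (simp add: pka_of_simps mult.assoc)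
  also have "?l u' * (?r \<alpha>' * ?l \<beta>) = ?l (u' @ \<beta>) * ?r \<alpha>'"
    by (simp add: lword_rword_commute[symmetric] pka_of_word_append mult.assoc)
  also have "?l w * ?r w * (1 * (pka_of (lgen b) * pka_of (rgen a)
        * (?l (u' @ \<beta>) * ?r \<alpha>' * pka_of (Star \<rho>))))
      \<sqsubseteq> ?l w * ?r w * (pka_of (Star match_trm) * (pka_of clash_trm
        * (pka_of (any_trm lgen) * pka_of (any_trm rgen) * pka_of (Star \<rho>))))"
    by (intro mult_below_mono below_refl word_below_any c)
      (simp add: star_free_pka.abs_eq[symmetric] one_below_star)
  also have "\<dots> \<sqsubseteq> pka_of (Star match_trm) * (pka_of clash_trm
        * (pka_of (any_trm lgen) * pka_of (any_trm rgen) * pka_of (Star \<rho>)))"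
    by (rule match_absorb)
  also have "\<dots> \<sqsubseteq> pka_of (harmless_trm \<rho>)"
    unfolding harmless_trm_def times_free_pka.abs_eq plus_free_pka.abs_eq[symmetric]
    by (simp add: times_free_pka.abs_eq[symmetric] mult.assoc below_add2)
  finally show ?thesis .
qed

lemma mult_rules_trm_below:
  assumes "\<And>\<alpha> \<beta>. (\<alpha>, \<beta>) \<in> set P \<Longrightarrow>
    x * (pka_of (word rgen \<alpha>) * pka_of (word lgen \<beta>) * y) \<sqsubseteq> z"
  shows "x * (pka_of (rules_trm P) * y) \<sqsubseteq> z"
  using assms
proof (induction P rule: rules_trm.induct)
  case 1
  then show ?case by (simp add: pka_of_simps zero_below)
next
  case (2 \<alpha> \<beta> P)
  then show ?case
    by (simp add: plus_free_pka.abs_eq[symmetric] times_free_pka.abs_eq[symmetric]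
        distrib_left distrib_right add_below)
qed

lemma run_below_harmlessI:
  assumes u: "u = False # u'"
    and rules: "\<And>\<alpha> \<beta>. (\<alpha>, \<beta>) \<in> set P \<Longrightarrow> clash \<alpha> u \<or> (\<exists>w. u = \<alpha> @ w
      \<and> pka_of (run_trm (w @ \<beta>) (rules_trm P)) \<sqsubseteq> pka_of (harmless_trm (rules_trm P)))"
  shows "pka_of (run_trm u (rules_trm P)) \<sqsubseteq> pka_of (harmless_trm (rules_trm P))"
proof -
  let ?\<rho> = "rules_trm P"
  have "pka_of (word lgen u) * (pka_of ?\<rho> * pka_of (Star ?\<rho>)) \<sqsubseteq> pka_of (harmless_trm ?\<rho>)"
  proof (rule mult_rules_trm_below)
    fix \<alpha> \<beta> assume "(\<alpha>, \<beta>) \<in> set P"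
    from rules[OF this] show "pka_of (word lgen u) *
        (pka_of (word rgen \<alpha>) * pka_of (word lgen \<beta>) * pka_of (Star ?\<rho>)) \<sqsubseteq> pka_of (harmless_trm ?\<rho>)"
    proof (elim disjE exE conjE)
      fix w assume w: "u = \<alpha> @ w"
        and IH: "pka_of (run_trm (w @ \<beta>) ?\<rho>) \<sqsubseteq> pka_of (harmless_trm ?\<rho>)"
      have "pka_of (word lgen u) * (pka_of (word rgen \<alpha>) * pka_of (word lgen \<beta>) * pka_of (Star ?\<rho>))
          = pka_of (word lgen (\<alpha> @ w)) * pka_of (word rgen (\<alpha> @ []))
            * (pka_of (word lgen \<beta>) * pka_of (Star ?\<rho>))"
        by (simp add: w mult.assoc)
      also have "\<dots> = pka_of (word lgen \<alpha>) * pka_of (word rgen \<alpha>) * pka_of (run_trm (w @ \<beta>) ?\<rho>)"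
        unfolding lword_rword_append run_trm_def times_free_pka.abs_eq[symmetric]
        by (simp add: pka_of_word_append mult.assoc one_free_pka.abs_eq[symmetric])
      also have "\<dots> \<sqsubseteq> pka_of (word lgen \<alpha>) * pka_of (word rgen \<alpha>) * pka_of (harmless_trm ?\<rho>)"
        by (intro mult_below_mono below_refl IH)
      also have "\<dots> \<sqsubseteq> pka_of (harmless_trm ?\<rho>)"
        by (rule match_absorb_harmless)
      finally show ?thesis .
    qed (rule clash_below_harmless)
  qed
  moreover have "pka_of (run_trm u ?\<rho>)
      = pka_of (word lgen u) + pka_of (word lgen u) * (pka_of ?\<rho> * pka_of (Star ?\<rho>))"
    unfolding run_trm_def times_free_pka.abs_eq[symmetric] star_free_pka.abs_eq[symmetric]
    by (subst star_unfold) (simp add: distrib_left)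
  ultimately show ?thesis
    using stopped_below_harmless[OF u] by (simp add: add_below)
qed

lemma halting_run_below_harmless:
  assumes det: "deterministic (set P)"
    and starts: "\<And>\<alpha> \<beta>. (\<alpha>, \<beta>) \<in> set P \<Longrightarrow> \<exists>\<alpha>'. \<alpha> = False # \<alpha>'"
    and run: "(post_step (set P))\<^sup>*\<^sup>* u (False # v)"
    and halt: "\<And>\<alpha> \<beta>. (\<alpha>, \<beta>) \<in> set P \<Longrightarrow> clash \<alpha> (False # v)"
  shows "pka_of (run_trm u (rules_trm P)) \<sqsubseteq> pka_of (harmless_trm (rules_trm P))"
  using run
proof (induction rule: converse_rtranclp_induct)
  case base
  show ?case by (rule run_below_harmlessI[OF refl]) (use halt in blast)
next
  case (step u u')
  obtain u'' where "u = False # u''"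
    using step.hyps(1) starts unfolding post_step_def by fastforce
  then show ?case
    by (rule run_below_harmlessI) (use post_step_deterministic[OF det step.hyps(1)] step.IH in blast)
qed

section \<open>Rejecting runs in languages\<close>

fun lefts :: "('a + 'b) list \<Rightarrow> 'a list" where
  "lefts [] = []"
| "lefts (Inl a # w) = a # lefts w"
| "lefts (Inr b # w) = lefts w"

fun rights :: "('a + 'b) list \<Rightarrow> 'b list" where
  "rights [] = []"
| "rights (Inl a # w) = rights w"
| "rights (Inr b # w) = b # rights w"

lemma lefts_append [simp]: "lefts (u @ v) = lefts u @ lefts v"
  by (induction u rule: lefts.induct) auto

lemma rights_append [simp]: "rights (u @ v) = rights u @ rights v"
  by (induction u rule: rights.induct) auto

lemma str_eq_lefts_rights:
  fixes u v :: "(sigma + sigma) list"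
  shows "str_eq u v \<Longrightarrow> lefts u = lefts v \<and> rights u = rights v"
proof (induction rule: str_eq.induct)
  case (str_swap x y)
  then show ?case by (cases x; cases y) (auto simp: comm_sigma_def)
qed auto

lift_definition left_part :: "(sigma + sigma) strings \<Rightarrow> sigma list" is lefts
  by (simp add: str_eq_lefts_rights)

lift_definition right_part :: "(sigma + sigma) strings \<Rightarrow> sigma list" is rights
  by (simp add: str_eq_lefts_rights)

lemma part_simps [simp]:
  "left_part 1 = []" "right_part 1 = []"
  "left_part (x * y) = left_part x @ left_part y"
  "right_part (x * y) = right_part x @ right_part y"
  "left_part (letter (Inl a)) = [a]" "right_part (letter (Inl a)) = []"
  "left_part (letter (Inr a)) = []" "right_part (letter (Inr a)) = [a]"
  by (transfer; simp)+

definition language :: "(sigma + sigma) trm \<Rightarrow> (sigma + sigma) strings set"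
  where "language t = strings_of (trm_lang t)"

lemma language_simps:
  "language Zero = {}" "language One = {1}"
  "language (Plus s t) = language s \<union> language t"
  "language (Times s t) = language s * language t"
  "language (Star t) = lang_star (language t)"
  "language (lgen b) = {letter (Inl (sigma_of b))}"
  "language (rgen b) = {letter (Inr (sigma_of b))}"
  by (simp_all add: language_def zero_lang.rep_eq one_lang.rep_eq plus_lang.rep_eq times_lang.rep_eq
      star_lang.rep_eq lang_letter.rep_eq lgen_def rgen_def)

lemma lang_star_induct [consumes 1, case_names one mult]:
  assumes "x \<in> lang_star A" and "Q 1" and "\<And>a y. a \<in> A \<Longrightarrow> Q y \<Longrightarrow> Q (a * y)"
  shows "Q x"
proof -
  obtain n where "x \<in> A ^ n" using assms(1) unfolding lang_star_def by auto
  then show ?thesis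
    by (induction n arbitrary: x) (auto elim!: set_times_elim intro: assms(2,3))
qed

lemma one_in_lang_star: "1 \<in> lang_star A"
  by (subst lang_star_unfold) simp

lemma lang_star_mult_right: "x \<in> lang_star A \<Longrightarrow> a \<in> A \<Longrightarrow> x * a \<in> lang_star A"
proof -
  assume "x \<in> lang_star A" "a \<in> A"
  then obtain n where "x \<in> A ^ n" unfolding lang_star_def by auto
  then have "x * a \<in> A ^ Suc n"
    unfolding power_Suc2 using \<open>a \<in> A\<close> by (rule set_times_intro)
  then show "x * a \<in> lang_star A" unfolding lang_star_def by blast
qed

lemma language_match_star:
  "x \<in> language (Star match_trm) \<Longrightarrow> left_part x = right_part x"
  unfolding match_trm_def language_simps
  by (induction rule: lang_star_induct) (auto elim!: set_times_elim)

lemma language_any_lgen: "x \<in> language (any_trm lgen) \<Longrightarrow> right_part x = []"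
  unfolding any_trm_def language_simps
  by (induction rule: lang_star_induct) auto

lemma language_lword: "\<exists>x. language (word lgen u) = {x} \<and> left_part x = map sigma_of u \<and> right_part x = []"
proof (induction u)
  case (Cons a u)
  then show ?case by (auto simp: language_simps set_times_def)
qed (simp add: language_simps)

lemma language_rword: "\<exists>x. language (word rgen u) = {x} \<and> right_part x = map sigma_of u \<and> left_part x = []"
proof (induction u)
  case (Cons a u)
  then show ?case by (auto simp: language_simps set_times_def)
qed (simp add: language_simps)

lemma language_harmless:
  assumes "x \<in> language (harmless_trm \<rho>)"
  shows "\<not> (\<exists>v. left_part x = right_part x @ Sigma1 # v)"
proof -
  from assms consider
    (stopped) a b where "x = a * (letter (Inl Sigma0) * b)" "a \<in> language (Star match_trm)"
      "b \<in> language (any_trm lgen)"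
  | (clash) a c d where "x = a * (c * d)" "a \<in> language (Star match_trm)" "c \<in> language clash_trm"
    unfolding harmless_trm_def language_simps(3,4)
    by (auto simp: language_simps(6) elim!: set_times_elim)
  then show ?thesis
  proof cases
    case stopped
    then show ?thesis using language_match_star[of a] language_any_lgen[of b] by auto
  next
    case clash
    then show ?thesis
      using language_match_star[of a] by (auto simp: clash_trm_def language_simps elim!: set_times_elim)
  qed
qed

lemma language_rules_trm:
  "(\<alpha>, \<beta>) \<in> set P \<Longrightarrow> \<exists>y \<in> language (rules_trm P).
    left_part y = map sigma_of \<beta> \<and> right_part y = map sigma_of \<alpha>"
proof (induction P rule: rules_trm.induct)
  case (2 \<alpha>' \<beta>' P)
  show ?case
  proof (cases "(\<alpha>, \<beta>) = (\<alpha>', \<beta>')")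
    case True
    then show ?thesis
      using language_lword[of \<beta>] language_rword[of \<alpha>]
      by (auto simp: language_simps set_times_def)
  qed (use 2 in \<open>auto simp: language_simps\<close>)
qed simp

lemma language_run:
  assumes "(post_step (set P))\<^sup>*\<^sup>* u v"
  shows "\<exists>x \<in> language (run_trm u (rules_trm P)). left_part x = right_part x @ map sigma_of v"
proof -
  obtain x\<^sub>0 where x\<^sub>0: "language (word lgen u) = {x\<^sub>0}" "left_part x\<^sub>0 = map sigma_of u" "right_part x\<^sub>0 = []"
    using language_lword by blast
  from assms have "\<exists>y \<in> lang_star (language (rules_trm P)).
      left_part (x\<^sub>0 * y) = right_part (x\<^sub>0 * y) @ map sigma_of v"
  proof (induction rule: rtranclp_induct)
    case base
    show ?case by (rule bexI[OF _ one_in_lang_star]) (simp add: x\<^sub>0)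
  next
    case (step v v')
    then obtain y where y: "y \<in> lang_star (language (rules_trm P))"
      "left_part (x\<^sub>0 * y) = right_part (x\<^sub>0 * y) @ map sigma_of v" by blast
    obtain \<alpha> \<beta> w where r: "(\<alpha>, \<beta>) \<in> set P" "v = \<alpha> @ w" "v' = w @ \<beta>"
      using step.hyps(2) unfolding post_step_def by blast
    obtain z where z: "z \<in> language (rules_trm P)" "left_part z = map sigma_of \<beta>"
      "right_part z = map sigma_of \<alpha>"
      using language_rules_trm[OF r(1)] by blast
    show ?case
      by (rule bexI[OF _ lang_star_mult_right[OF y(1) z(1)]]) (use y(2) z r in simp)
  qed
  then show ?thesis
    unfolding run_trm_def language_simps x\<^sub>0(1) by (meson set_times_intro singletonI)
qed

lemma rejecting_run_language:
  assumes "(post_step (set P))\<^sup>*\<^sup>* u (True # v)"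
  shows "trm_lang (Plus (run_trm u (rules_trm P)) (harmless_trm (rules_trm P)))
    \<noteq> trm_lang (harmless_trm (rules_trm P))"
proof
  assume "trm_lang (Plus (run_trm u (rules_trm P)) (harmless_trm (rules_trm P)))
    = trm_lang (harmless_trm (rules_trm P))"
  then have "language (run_trm u (rules_trm P)) \<subseteq> language (harmless_trm (rules_trm P))"
    by (metis Un_upper1 language_def language_simps(3))
  then show False
    using language_run[OF assms] language_harmless by fastforce
qed

section \<open>Loop programs for the recursive functions\<close>

datatype cmd = Add nat nat | Seq cmd cmd | Loop nat cmd

text \<open>Every iteration of \<open>Loop r c\<close> decrements register \<open>r\<close> before it runs \<open>c\<close>.\<close>

inductive exec :: "cmd \<Rightarrow> (nat \<Rightarrow> nat) \<Rightarrow> (nat \<Rightarrow> nat) \<Rightarrow> bool" where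
  exec_Add: "exec (Add a r) \<sigma> (\<sigma>(r := \<sigma> r + a))"
| exec_Seq: "exec c \<sigma> \<sigma>' \<Longrightarrow> exec d \<sigma>' \<sigma>'' \<Longrightarrow> exec (Seq c d) \<sigma> \<sigma>''"
| exec_Loop_0: "\<sigma> r = 0 \<Longrightarrow> exec (Loop r c) \<sigma> \<sigma>"
| exec_Loop_Suc: "\<sigma> r = Suc a \<Longrightarrow> exec c (\<sigma>(r := a)) \<sigma>' \<Longrightarrow> exec (Loop r c) \<sigma>' \<sigma>''
    \<Longrightarrow> exec (Loop r c) \<sigma> \<sigma>''"

definition clear :: "nat \<Rightarrow> cmd"
  where "clear r = Loop r (Add 0 r)"

definition copy :: "nat \<Rightarrow> nat \<Rightarrow> nat \<Rightarrow> cmd"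
  where "copy a d t = Seq (clear d) (Seq (clear t)
    (Seq (Loop a (Seq (Add 1 d) (Add 1 t))) (Loop t (Add 1 a))))"

lemma exec_clear: "exec (clear r) \<sigma> (\<sigma>(r := 0))"
proof (induction "\<sigma> r" arbitrary: \<sigma>)
  case 0
  then have "\<sigma>(r := 0) = \<sigma>" by auto
  then show ?case using 0 by (simp add: clear_def exec_Loop_0)
next
  case (Suc x)
  have "exec (Add 0 r) (\<sigma>(r := x)) (\<sigma>(r := x))"
    using exec_Add[of 0 r "\<sigma>(r := x)"] by simp
  moreover have "exec (clear r) (\<sigma>(r := x)) (\<sigma>(r := 0))"
    using Suc.hyps(1)[of "\<sigma>(r := x)"] by simp
  ultimately show ?case
    unfolding clear_def by (rule exec_Loop_Suc[of \<sigma> r x, OF Suc.hyps(2)[symmetric]])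
qed

lemma exec_copy_out:
  assumes "a \<noteq> d" "a \<noteq> t" "d \<noteq> t"
  shows "exec (Loop a (Seq (Add 1 d) (Add 1 t))) \<sigma>
    (\<sigma>(a := 0, d := \<sigma> d + \<sigma> a, t := \<sigma> t + \<sigma> a))"
proof (induction "\<sigma> a" arbitrary: \<sigma>)
  case 0
  then have "\<sigma>(a := 0, d := \<sigma> d + \<sigma> a, t := \<sigma> t + \<sigma> a) = \<sigma>" by auto
  then show ?case using 0 exec_Loop_0 by metis
next
  case (Suc x)
  let ?\<sigma> = "\<sigma>(a := x, d := \<sigma> d + 1, t := \<sigma> t + 1)"
  have "exec (Seq (Add 1 d) (Add 1 t)) (\<sigma>(a := x)) ?\<sigma>"
    using assms exec_Seq[OF exec_Add[of 1 d "\<sigma>(a := x)"] exec_Add[of 1 t]] by simp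
  moreover have "?\<sigma>(a := 0, d := ?\<sigma> d + ?\<sigma> a, t := ?\<sigma> t + ?\<sigma> a)
      = \<sigma>(a := 0, d := \<sigma> d + \<sigma> a, t := \<sigma> t + \<sigma> a)"
    using assms Suc.hyps(2) by (auto simp: fun_eq_iff)
  moreover have "x = ?\<sigma> a" using assms by simp
  note Suc.hyps(1)[of ?\<sigma>, OF this]
  ultimately show ?case
    by (intro exec_Loop_Suc[of \<sigma> a x, OF Suc.hyps(2)[symmetric]]) (assumption, simp only:)
qed

lemma exec_copy_back:
  assumes "a \<noteq> t"
  shows "exec (Loop t (Add 1 a)) \<sigma> (\<sigma>(a := \<sigma> a + \<sigma> t, t := 0))"
proof (induction "\<sigma> t" arbitrary: \<sigma>)
  case 0
  then have "\<sigma>(a := \<sigma> a + \<sigma> t, t := 0) = \<sigma>" by auto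
  then show ?case using 0 exec_Loop_0 by metis
next
  case (Suc x)
  let ?\<sigma> = "\<sigma>(t := x, a := \<sigma> a + 1)"
  have "exec (Add 1 a) (\<sigma>(t := x)) ?\<sigma>"
    using assms exec_Add[of 1 a "\<sigma>(t := x)"] by simp
  moreover have "?\<sigma>(a := ?\<sigma> a + ?\<sigma> t, t := 0) = \<sigma>(a := \<sigma> a + \<sigma> t, t := 0)"
    using assms Suc.hyps(2) by (auto simp: fun_eq_iff)
  moreover have "x = ?\<sigma> t" using assms by simp
  note Suc.hyps(1)[of ?\<sigma>, OF this]
  ultimately show ?case
    by (intro exec_Loop_Suc[of \<sigma> t x, OF Suc.hyps(2)[symmetric]]) (assumption, simp only:)
qed

lemma exec_copy:
  assumes "a \<noteq> d" "a \<noteq> t" "d \<noteq> t"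
  shows "exec (copy a d t) \<sigma> (\<sigma>(d := \<sigma> a, t := 0))"
proof -
  let ?\<sigma>1 = "\<sigma>(d := 0, t := 0)"
  let ?\<sigma>2 = "?\<sigma>1(a := 0, d := ?\<sigma>1 d + ?\<sigma>1 a, t := ?\<sigma>1 t + ?\<sigma>1 a)"
  have "?\<sigma>2(a := ?\<sigma>2 a + ?\<sigma>2 t, t := 0) = \<sigma>(d := \<sigma> a, t := 0)"
    using assms by (auto simp: fun_eq_iff)
  then show ?thesis
    unfolding copy_def
    using exec_Seq[OF exec_clear[of d \<sigma>] exec_Seq[OF exec_clear[of t "\<sigma>(d := 0)"]
      exec_Seq[OF exec_copy_out[OF assms, of ?\<sigma>1] exec_copy_back[OF assms(2), of ?\<sigma>2]]]]
    by (simp only:)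
qed

text \<open>
  The arguments are read from the registers \<open>as\<close>, which lie below \<open>d\<close>; the result is left in
  register \<open>d\<close>, and all registers above \<open>d\<close> are scratch space with arbitrary initial contents.
\<close>

fun compile :: "recf \<Rightarrow> nat list \<Rightarrow> nat \<Rightarrow> cmd"
  and compile_list :: "recf list \<Rightarrow> nat list \<Rightarrow> nat \<Rightarrow> cmd" where
  "compile RZero as d = clear d"
| "compile RSuc as d = Seq (copy (hd as) d (Suc d)) (Add 1 d)"
| "compile (RProj i) as d = copy (as ! i) d (Suc d)"
| "compile (RComp f gs) as d = Seq (compile_list gs as (Suc d))
    (Seq (compile f [Suc d..<Suc d + length gs] (Suc d + length gs))
      (copy (Suc d + length gs) d (Suc (Suc d + length gs))))"
| "compile (RPrim f g) as d = Seq (compile f (tl as) d) (Seq (clear (d + 1))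
    (Seq (copy (hd as) (d + 2) (d + 3))
      (Loop (d + 2) (Seq (compile g ((d + 1) # d # tl as) (d + 3))
        (Seq (copy (d + 3) d (d + 4)) (Add 1 (d + 1)))))))"
| "compile (RMin f) as d = Seq (clear d) (Seq (compile f (d # as) (d + 1))
    (Loop (d + 1) (Seq (Add 1 d) (compile f (d # as) (d + 1)))))"
| "compile_list [] as d = Add 0 d"
| "compile_list (g # gs) as d = Seq (compile g as d) (compile_list gs as (Suc d))"

definition implements :: "recf \<Rightarrow> bool"
  where "implements p \<longleftrightarrow> (\<forall>as d \<sigma> y. (\<forall>a \<in> set as. a < d) \<longrightarrow> rec_eval p (map \<sigma> as) y \<longrightarrow>
    (\<exists>\<sigma>'. exec (compile p as d) \<sigma> \<sigma>' \<and> \<sigma>' d = y \<and> (\<forall>r<d. \<sigma>' r = \<sigma> r)))"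

lemma implementsD:
  assumes "implements p" "\<forall>a \<in> set as. a < d" "rec_eval p xs y" "map \<sigma> as = xs"
  obtains \<sigma>' where "exec (compile p as d) \<sigma> \<sigma>'" "\<sigma>' d = y" "\<And>r. r < d \<Longrightarrow> \<sigma>' r = \<sigma> r"
  using assms unfolding implements_def by blast

lemma exec_compile_list:
  assumes "\<And>g. g \<in> set gs \<Longrightarrow> implements g" and "list_all2 (\<lambda>g y. rec_eval g xs y) gs ys"
    and "map \<sigma> as = xs" and "\<forall>a \<in> set as. a < d"
  shows "\<exists>\<sigma>'. exec (compile_list gs as d) \<sigma> \<sigma>' \<and> map \<sigma>' [d..<d + length gs] = ys
    \<and> (\<forall>r<d. \<sigma>' r = \<sigma> r)"
  using assms
proof (induction gs arbitrary: ys d \<sigma>)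
  case Nil
  then show ?case using exec_Add[of 0 d \<sigma>] by auto
next
  case (Cons g gs)
  obtain y ys' where ys: "ys = y # ys'" "rec_eval g xs y" "list_all2 (\<lambda>g y. rec_eval g xs y) gs ys'"
    using Cons.prems(2) by (auto simp: list_all2_Cons1)
  obtain \<sigma>1 where 1: "exec (compile g as d) \<sigma> \<sigma>1" "\<sigma>1 d = y" "\<And>r. r < d \<Longrightarrow> \<sigma>1 r = \<sigma> r"
    using implementsD[OF _ Cons.prems(4) ys(2) Cons.prems(3)] Cons.prems(1) by auto
  have "map \<sigma>1 as = xs" using Cons.prems(3,4) 1(3) by auto
  moreover have "\<forall>a \<in> set as. a < Suc d" using Cons.prems(4) by auto
  ultimately obtain \<sigma>2 where 2: "exec (compile_list gs as (Suc d)) \<sigma>1 \<sigma>2"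
    "map \<sigma>2 [Suc d..<Suc d + length gs] = ys'" "\<forall>r<Suc d. \<sigma>2 r = \<sigma>1 r"
    using Cons.IH[of ys' \<sigma>1 "Suc d"] Cons.prems(1) ys(3) by auto
  have "[d..<d + length (g # gs)] = d # [Suc d..<Suc d + length gs]"
    by (simp add: upt_rec)
  then have "map \<sigma>2 [d..<d + length (g # gs)] = ys"
    using 2(2,3) 1(2) ys(1) by simp
  then show ?case using exec_Seq[OF 1(1) 2(1)] 1(3) 2(3) by auto
qed

lemma rec_prim_values:
  assumes "rec_eval (RPrim f g) (n # xs) z"
  shows "\<exists>Y. rec_eval f xs (Y 0) \<and> (\<forall>i<n. rec_eval g (i # Y i # xs) (Y (Suc i))) \<and> Y n = z"
  using assms
proof (induction n arbitrary: z)
  case 0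
  then show ?case by (auto elim!: rec_prim_0E)
next
  case (Suc n)
  then obtain y where y: "rec_eval (RPrim f g) (n # xs) y" "rec_eval g (n # y # xs) z"
    by (auto elim: rec_prim_SucE)
  from Suc.IH[OF y(1)] obtain Y where Y: "rec_eval f xs (Y 0)"
    "\<forall>i<n. rec_eval g (i # Y i # xs) (Y (Suc i))" "Y n = y" by blast
  show ?case
    by (rule exI[of _ "Y(Suc n := z)"]) (use Y y(2) in \<open>auto simp: less_Suc_eq\<close>)
qed

lemma exec_prim_loop:
  assumes "implements g" and "\<forall>a \<in> set as. a < d"
    and "\<forall>i<n. rec_eval g (i # Y i # xs) (Y (Suc i))"
    and "i \<le> n" "map \<sigma> as = xs" "\<sigma> d = Y i" "\<sigma> (d + 1) = i" "\<sigma> (d + 2) = n - i"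
  shows "\<exists>\<sigma>'. exec (Loop (d + 2) (Seq (compile g ((d + 1) # d # as) (d + 3))
        (Seq (copy (d + 3) d (d + 4)) (Add 1 (d + 1))))) \<sigma> \<sigma>' \<and> \<sigma>' d = Y n \<and> (\<forall>r<d. \<sigma>' r = \<sigma> r)"
  using assms(4-)
proof (induction "n - i" arbitrary: i \<sigma>)
  case 0
  then show ?case using exec_Loop_0[of \<sigma> "d + 2"] by auto
next
  case (Suc m)
  let ?\<sigma> = "\<sigma>(d + 2 := m)"
  have "i < n" using Suc.hyps(2) by simp
  then have e: "rec_eval g (i # Y i # xs) (Y (Suc i))" using assms(3) by blast
  have a: "\<forall>a \<in> set ((d + 1) # d # as). a < d + 3" using assms(2) by auto
  have m: "map ?\<sigma> ((d + 1) # d # as) = i # Y i # xs" using assms(2) Suc.prems by fastforce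
  obtain \<sigma>1 where 1: "exec (compile g ((d + 1) # d # as) (d + 3)) ?\<sigma> \<sigma>1" "\<sigma>1 (d + 3) = Y (Suc i)"
    "\<And>r. r < d + 3 \<Longrightarrow> \<sigma>1 r = ?\<sigma> r"
    using implementsD[OF assms(1) a e m] by blast
  let ?\<sigma>2 = "\<sigma>1(d := \<sigma>1 (d + 3), d + 4 := 0)"
  let ?\<sigma>3 = "?\<sigma>2(d + 1 := ?\<sigma>2 (d + 1) + 1)"
  have 2: "exec (copy (d + 3) d (d + 4)) \<sigma>1 ?\<sigma>2" by (rule exec_copy) auto
  have 3: "exec (Add 1 (d + 1)) ?\<sigma>2 ?\<sigma>3" by (rule exec_Add)
  have pre: "\<forall>r<d. ?\<sigma>3 r = \<sigma> r" using 1(3) by simp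
  have "\<exists>\<sigma>'. exec (Loop (d + 2) (Seq (compile g ((d + 1) # d # as) (d + 3))
        (Seq (copy (d + 3) d (d + 4)) (Add 1 (d + 1))))) ?\<sigma>3 \<sigma>' \<and> \<sigma>' d = Y n \<and> (\<forall>r<d. \<sigma>' r = ?\<sigma>3 r)"
  proof (rule Suc.hyps(1)[of "Suc i"])
    have "map ?\<sigma>3 as = map \<sigma> as" using pre assms(2) by (intro map_cong refl) blast
    then show "map ?\<sigma>3 as = xs" using Suc.prems(2) by metis
  qed (use Suc.hyps(2) Suc.prems 1 in auto)
  then obtain \<sigma>' where 4: "exec (Loop (d + 2) (Seq (compile g ((d + 1) # d # as) (d + 3))
        (Seq (copy (d + 3) d (d + 4)) (Add 1 (d + 1))))) ?\<sigma>3 \<sigma>'" "\<sigma>' d = Y n" "\<forall>r<d. \<sigma>' r = ?\<sigma>3 r"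
    by blast
  have "\<sigma> (d + 2) = Suc m" using Suc.hyps(2) Suc.prems by simp
  from exec_Loop_Suc[OF this exec_Seq[OF 1(1) exec_Seq[OF 2 3]] 4(1)] show ?case
    using 4(2,3) pre by (intro exI[of _ \<sigma>']) simp
qed

lemma exec_min_loop:
  assumes "implements f" and "\<forall>a \<in> set as. a < d"
    and "\<forall>i\<le>n. rec_eval f (i # xs) (Y i)" and "\<forall>i<n. Y i \<noteq> 0" and "Y n = 0"
    and "i \<le> n" "map \<sigma> as = xs" "\<sigma> d = i" "\<sigma> (d + 1) = Y i"
  shows "\<exists>\<sigma>'. exec (Loop (d + 1) (Seq (Add 1 d) (compile f (d # as) (d + 1)))) \<sigma> \<sigma>'
    \<and> \<sigma>' d = n \<and> (\<forall>r<d. \<sigma>' r = \<sigma> r)"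
  using assms(6-)
proof (induction "n - i" arbitrary: i \<sigma>)
  case 0
  then show ?case using exec_Loop_0[of \<sigma> "d + 1"] assms(5) by auto
next
  case (Suc m)
  have "i < n" using Suc.hyps(2) by simp
  then obtain z where z: "Y i = Suc z" using assms(4) not0_implies_Suc by blast
  let ?\<sigma> = "\<sigma>(d + 1 := z)"
  let ?\<sigma>1 = "?\<sigma>(d := ?\<sigma> d + 1)"
  have 1: "exec (Add 1 d) ?\<sigma> ?\<sigma>1" by (rule exec_Add)
  have e: "rec_eval f (Suc i # xs) (Y (Suc i))" using assms(3) \<open>i < n\<close> by simp
  have a: "\<forall>a \<in> set (d # as). a < d + 1" using assms(2) by auto
  have m: "map ?\<sigma>1 (d # as) = Suc i # xs" using assms(2) Suc.prems by fastforce
  obtain \<sigma>2 where 2: "exec (compile f (d # as) (d + 1)) ?\<sigma>1 \<sigma>2" "\<sigma>2 (d + 1) = Y (Suc i)"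
    "\<And>r. r < d + 1 \<Longrightarrow> \<sigma>2 r = ?\<sigma>1 r"
    using implementsD[OF assms(1) a e m] by blast
  have pre: "\<forall>r<d. \<sigma>2 r = \<sigma> r" using 2(3) by simp
  have "\<exists>\<sigma>'. exec (Loop (d + 1) (Seq (Add 1 d) (compile f (d # as) (d + 1)))) \<sigma>2 \<sigma>'
    \<and> \<sigma>' d = n \<and> (\<forall>r<d. \<sigma>' r = \<sigma>2 r)"
  proof (rule Suc.hyps(1)[of "Suc i"])
    show "map \<sigma>2 as = xs" using pre assms(2) Suc.prems(2) by auto
  qed (use Suc.hyps(2) Suc.prems 2 in auto)
  then obtain \<sigma>' where 3: "exec (Loop (d + 1) (Seq (Add 1 d) (compile f (d # as) (d + 1)))) \<sigma>2 \<sigma>'"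
    "\<sigma>' d = n" "\<forall>r<d. \<sigma>' r = \<sigma>2 r" by blast
  have "\<sigma> (d + 1) = Suc z" using z Suc.prems by simp
  from exec_Loop_Suc[OF this exec_Seq[OF 1 2(1)] 3(1)] show ?case
    using 3(2,3) pre by (intro exI[of _ \<sigma>']) simp
qed

lemma implements_all: "implements p"
proof (induction p)
  case RZero
  show ?case unfolding implements_def
  proof (intro allI impI)
    fix as :: "nat list" and d y and \<sigma> :: "nat \<Rightarrow> nat"
    assume "rec_eval RZero (map \<sigma> as) y"
    then show "\<exists>\<sigma>'. exec (compile RZero as d) \<sigma> \<sigma>' \<and> \<sigma>' d = y \<and> (\<forall>r<d. \<sigma>' r = \<sigma> r)"
      using exec_clear[of d \<sigma>] by (intro exI[of _ "\<sigma>(d := 0)"]) (auto elim: rec_zeroE)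
  qed
next
  case RSuc
  show ?case unfolding implements_def
  proof (intro allI impI)
    fix as :: "nat list" and d y and \<sigma> :: "nat \<Rightarrow> nat"
    assume a: "\<forall>a \<in> set as. a < d" and "rec_eval RSuc (map \<sigma> as) y"
    then obtain b bs where as: "as = b # bs" "y = Suc (\<sigma> b)" by (auto elim: rec_sucE)
    have "exec (copy b d (Suc d)) \<sigma> (\<sigma>(d := \<sigma> b, Suc d := 0))"
      using a as by (intro exec_copy) auto
    from exec_Seq[OF this exec_Add[of 1 d]]
    have "exec (compile RSuc as d) \<sigma> (\<sigma>(Suc d := 0, d := y))"
      using as by simp
    then show "\<exists>\<sigma>'. exec (compile RSuc as d) \<sigma> \<sigma>' \<and> \<sigma>' d = y \<and> (\<forall>r<d. \<sigma>' r = \<sigma> r)"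
      by (intro exI[of _ "\<sigma>(Suc d := 0, d := y)"]) simp
  qed
next
  case (RProj i)
  show ?case unfolding implements_def
  proof (intro allI impI)
    fix as :: "nat list" and d y and \<sigma> :: "nat \<Rightarrow> nat"
    assume a: "\<forall>a \<in> set as. a < d" and "rec_eval (RProj i) (map \<sigma> as) y"
    then have i: "i < length as" "y = \<sigma> (as ! i)" by (auto elim: rec_projE)
    then have "as ! i < d" using a by simp
    then have "exec (copy (as ! i) d (Suc d)) \<sigma> (\<sigma>(d := \<sigma> (as ! i), Suc d := 0))"
      by (intro exec_copy) auto
    then show "\<exists>\<sigma>'. exec (compile (RProj i) as d) \<sigma> \<sigma>' \<and> \<sigma>' d = y \<and> (\<forall>r<d. \<sigma>' r = \<sigma> r)"
      using i by (intro exI[of _ "\<sigma>(d := y, Suc d := 0)"]) simp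
  qed
next
  case (RComp f gs)
  show ?case unfolding implements_def
  proof (intro allI impI)
    fix as :: "nat list" and d y and \<sigma> :: "nat \<Rightarrow> nat"
    assume a: "\<forall>a \<in> set as. a < d" and "rec_eval (RComp f gs) (map \<sigma> as) y"
    then obtain ys where ys: "list_all2 (\<lambda>g y. rec_eval g (map \<sigma> as) y) gs ys" "rec_eval f ys y"
      by (auto elim: rec_compE)
    let ?e = "Suc d + length gs"
    obtain \<sigma>1 where 1: "exec (compile_list gs as (Suc d)) \<sigma> \<sigma>1" "map \<sigma>1 [Suc d..<?e] = ys"
      "\<forall>r<Suc d. \<sigma>1 r = \<sigma> r"
    proof -
      have "\<forall>a \<in> set as. a < Suc d" using a by auto
      from exec_compile_list[OF RComp.IH(2) ys(1) refl this] show ?thesis using that by blast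
    qed
    obtain \<sigma>2 where 2: "exec (compile f [Suc d..<?e] ?e) \<sigma>1 \<sigma>2" "\<sigma>2 ?e = y"
      "\<And>r. r < ?e \<Longrightarrow> \<sigma>2 r = \<sigma>1 r"
    proof -
      have "\<forall>a \<in> set [Suc d..<?e]. a < ?e" by (simp del: upt_Suc)
      from implementsD[OF RComp.IH(1) this ys(2) 1(2)] show ?thesis using that by blast
    qed
    have "exec (copy ?e d (Suc ?e)) \<sigma>2 (\<sigma>2(d := \<sigma>2 ?e, Suc ?e := 0))"
      by (intro exec_copy) auto
    from exec_Seq[OF 1(1) exec_Seq[OF 2(1) this]]
    show "\<exists>\<sigma>'. exec (compile (RComp f gs) as d) \<sigma> \<sigma>' \<and> \<sigma>' d = y \<and> (\<forall>r<d. \<sigma>' r = \<sigma> r)"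
      using 1(3) 2(2,3) by (intro exI[of _ "\<sigma>2(d := \<sigma>2 ?e, Suc ?e := 0)"]) simp
  qed
next
  case (RPrim f g)
  show ?case unfolding implements_def
  proof (intro allI impI)
    fix as :: "nat list" and d y and \<sigma> :: "nat \<Rightarrow> nat"
    assume a: "\<forall>a \<in> set as. a < d" and ev: "rec_eval (RPrim f g) (map \<sigma> as) y"
    have "as \<noteq> []"
      using ev by (cases rule: rec_eval.cases) auto
    then obtain b bs where as: "as = b # bs" by (cases as) auto
    obtain Y where Y: "rec_eval f (map \<sigma> bs) (Y 0)"
      "\<forall>i<\<sigma> b. rec_eval g (i # Y i # map \<sigma> bs) (Y (Suc i))" "Y (\<sigma> b) = y"
      using rec_prim_values[of f g "\<sigma> b" "map \<sigma> bs" y] ev as by auto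
    have b: "b < d" and bs: "\<forall>a \<in> set bs. a < d" using a as by auto
    obtain \<sigma>1 where 1: "exec (compile f bs d) \<sigma> \<sigma>1" "\<sigma>1 d = Y 0" "\<And>r. r < d \<Longrightarrow> \<sigma>1 r = \<sigma> r"
      using implementsD[OF RPrim.IH(1) bs Y(1) refl] by blast
    let ?\<sigma>2 = "\<sigma>1(d + 1 := 0)"
    let ?\<sigma>3 = "?\<sigma>2(d + 2 := ?\<sigma>2 b, d + 3 := 0)"
    have 2: "exec (clear (d + 1)) \<sigma>1 ?\<sigma>2" by (rule exec_clear)
    have 3: "exec (copy b (d + 2) (d + 3)) ?\<sigma>2 ?\<sigma>3" using b by (intro exec_copy) auto
    have pre: "\<forall>r<d. ?\<sigma>3 r = \<sigma> r" using 1(3) by simp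
    have m: "map ?\<sigma>3 bs = map \<sigma> bs" using pre bs by (intro map_cong refl) blast
    obtain \<sigma>' where 4: "exec (Loop (d + 2) (Seq (compile g ((d + 1) # d # bs) (d + 3))
        (Seq (copy (d + 3) d (d + 4)) (Add 1 (d + 1))))) ?\<sigma>3 \<sigma>'" "\<sigma>' d = Y (\<sigma> b)"
      "\<forall>r<d. \<sigma>' r = ?\<sigma>3 r"
    proof -
      have "?\<sigma>3 d = Y 0" "?\<sigma>3 (d + 1) = 0" "?\<sigma>3 (d + 2) = \<sigma> b - 0"
        using 1(2,3) b by simp_all
      from exec_prim_loop[OF RPrim.IH(2) bs Y(2) le0 m this] show ?thesis using that by blast
    qed
    from exec_Seq[OF 1(1) exec_Seq[OF 2 exec_Seq[OF 3 4(1)]]]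
    show "\<exists>\<sigma>'. exec (compile (RPrim f g) as d) \<sigma> \<sigma>' \<and> \<sigma>' d = y \<and> (\<forall>r<d. \<sigma>' r = \<sigma> r)"
      using as 4(2,3) Y(3) pre by (intro exI[of _ \<sigma>']) simp
  qed
next
  case (RMin f)
  show ?case unfolding implements_def
  proof (intro allI impI)
    fix as :: "nat list" and d y and \<sigma> :: "nat \<Rightarrow> nat"
    assume a: "\<forall>a \<in> set as. a < d" and ev: "rec_eval (RMin f) (map \<sigma> as) y"
    then have y: "rec_eval f (y # map \<sigma> as) 0" "\<forall>i<y. \<exists>z. rec_eval f (i # map \<sigma> as) (Suc z)"
      by (blast elim: rec_minE)+
    then obtain Z where Z: "\<forall>i<y. rec_eval f (i # map \<sigma> as) (Suc (Z i))" by metis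
    let ?Y = "\<lambda>i. if i < y then Suc (Z i) else 0"
    have Y: "\<forall>i\<le>y. rec_eval f (i # map \<sigma> as) (?Y i)" using y(1) Z by auto
    let ?\<sigma>1 = "\<sigma>(d := 0)"
    have 1: "exec (clear d) \<sigma> ?\<sigma>1" by (rule exec_clear)
    have a': "\<forall>a \<in> set (d # as). a < d + 1" using a by auto
    have m: "map ?\<sigma>1 (d # as) = 0 # map \<sigma> as" using a by auto
    obtain \<sigma>2 where 2: "exec (compile f (d # as) (d + 1)) ?\<sigma>1 \<sigma>2" "\<sigma>2 (d + 1) = ?Y 0"
      "\<And>r. r < d + 1 \<Longrightarrow> \<sigma>2 r = ?\<sigma>1 r"
      using implementsD[OF RMin.IH a' Y[rule_format, OF le0] m] by blast
    have m2: "map \<sigma>2 as = map \<sigma> as" using 2(3) a by auto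
    obtain \<sigma>' where 3: "exec (Loop (d + 1) (Seq (Add 1 d) (compile f (d # as) (d + 1)))) \<sigma>2 \<sigma>'"
      "\<sigma>' d = y" "\<forall>r<d. \<sigma>' r = \<sigma>2 r"
    proof -
      have "\<sigma>2 d = 0" using 2(3) by simp
      from exec_min_loop[OF RMin.IH a Y _ _ le0 m2 this 2(2)] show ?thesis using that by auto
    qed
    from exec_Seq[OF 1 exec_Seq[OF 2(1) 3(1)]]
    show "\<exists>\<sigma>'. exec (compile (RMin f) as d) \<sigma> \<sigma>' \<and> \<sigma>' d = y \<and> (\<forall>r<d. \<sigma>' r = \<sigma> r)"
      using 3(2,3) 2(3) by (intro exI[of _ \<sigma>']) simp
  qed
qed

section \<open>Post systems for loop programs\<close>

text \<open>
  Symbols are numbers: 0 rejects, 1 ends a register, 2 is a unary digit, 3 starts the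
  computation, and the other ones are control states. Only the code of 0 begins with \<open>True\<close>.
\<close>

definition sym_code :: "nat \<Rightarrow> bool list"
  where "sym_code s = replicate s False @ [True]"

definition enc :: "nat list \<Rightarrow> bool list"
  where "enc u = concat (map sym_code u)"

definition encode_rules :: "(nat list \<times> nat list) list \<Rightarrow> (bool list \<times> bool list) list"
  where "encode_rules P = map (\<lambda>(\<alpha>, \<beta>). (enc \<alpha>, enc \<beta>)) P"

lemma enc_append [simp]: "enc (u @ v) = enc u @ enc v"
  by (simp add: enc_def)

lemma enc_Cons: "enc (a # u) = sym_code a @ enc u"
  by (simp add: enc_def)

lemma clash_sym_code:
  assumes "a \<noteq> b"
  shows "clash (sym_code a) (sym_code b)"
proof -
  have *: "replicate (Suc (c + d)) False @ [True] = replicate c False @ False # replicate d False @ [True]"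
    for c d
    by (simp add: replicate_add replicate_app_Cons_same)
  show ?thesis
  proof (cases "a < b")
    case True
    then obtain d where "b = Suc (a + d)" using less_iff_Suc_add by auto
    then show ?thesis unfolding clash_def sym_code_def using *[of a d] by blast
  next
    case False
    then obtain d where "a = Suc (b + d)" using assms less_iff_Suc_add by (metis linorder_neqE_nat)
    then show ?thesis unfolding clash_def sym_code_def using *[of b d] by blast
  qed
qed

lemma clash_append_left: "clash u v \<Longrightarrow> clash (w @ u) (w @ v)"
  by (induction w) (auto intro: clash_Cons)

lemma clash_enc:
  assumes "clash u v"
  shows "clash (enc u) (enc v)"
proof -
  obtain w a b u' v' where *: "u = w @ a # u'" "v = w @ b # v'" "a \<noteq> b"
    using assms unfolding clash_def by blast
  then show ?thesis
    by (simp add: enc_Cons clash_append_left clash_append clash_sym_code)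
qed

lemma deterministic_encode_rules:
  "deterministic (set P) \<Longrightarrow> deterministic (set (encode_rules P))"
  unfolding deterministic_def encode_rules_def by (auto intro!: clash_enc)

lemma post_step_enc:
  "post_step (set P) u v \<Longrightarrow> post_step (set (encode_rules P)) (enc u) (enc v)"
  unfolding post_step_def encode_rules_def by force

lemma post_steps_enc:
  "(post_step (set P))\<^sup>*\<^sup>* u v \<Longrightarrow> (post_step (set (encode_rules P)))\<^sup>*\<^sup>* (enc u) (enc v)"
  by (induction rule: rtranclp_induct) (auto intro: rtranclp.rtrancl_into_rtrancl post_step_enc)

text \<open>
  \<open>ADD a r l\<close> adds \<open>a\<close> to register \<open>r\<close> and jumps to \<open>l\<close>. \<open>DJZ r l l'\<close> jumps to \<open>l'\<close> if register \<open>r\<close> is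
  zero; otherwise it decrements \<open>r\<close> and jumps to \<open>l\<close>.
\<close>

datatype instr = ADD nat nat nat | DJZ nat nat nat

text \<open>
  In \<open>state pc j m\<close> the instruction at \<open>pc\<close> is about to read register \<open>j\<close>, and \<open>m = 1\<close> iff it has
  already decremented a register. Label 0 is the rejecting exit.
\<close>

definition state :: "nat \<Rightarrow> nat \<Rightarrow> nat \<Rightarrow> nat"
  where "state pc j m = (if pc = 0 then 0 else 4 + prod_encode (pc, prod_encode (j, m)))"

fun out :: "nat \<Rightarrow> nat \<Rightarrow> instr \<Rightarrow> nat \<Rightarrow> nat \<Rightarrow> nat \<Rightarrow> nat list" where
  "out k pc (ADD a r l) j m x = (if x = 2 then [2, state pc j m]
    else (if j = r then replicate a 2 else [])
      @ [1, if Suc j < k then state pc (Suc j) m else state l 0 0])"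
| "out k pc (DJZ r l l') j m x = (if x = 2
    then if j = r \<and> m = 0 then [state pc j 1] else [2, state pc j m]
    else [1, if Suc j < k then state pc (Suc j) m else state (if m = 0 then l' else l) 0 0])"

text \<open>
  A control state at the front acts on the next symbol and goes to the back. Copying all data
  symbols then brings it to the front again. The dummy instruction at index 0 gets no rules.
\<close>

definition prog_rules :: "nat \<Rightarrow> instr list \<Rightarrow> (nat list \<times> nat list) list"
  where "prog_rules k prog = ([1], [1]) # ([2], [2]) # ([3], replicate k 1 @ [state 1 0 0]) #
    map (\<lambda>(pc, j, m, x). ([state pc j m, x], out k pc (prog ! pc) j m x))
      (List.product [1..<length prog] (List.product [0..<k] (List.product [0, 1] [1, 2])))"

lemma instr_in_prog_rules:
  assumes "1 \<le> pc" "pc < length prog" "j < k" "m \<le> 1" "x = 1 \<or> x = 2"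
  shows "([state pc j m, x], out k pc (prog ! pc) j m x) \<in> set (prog_rules k prog)"
proof -
  have "(pc, j, m, x) \<in> set (List.product [1..<length prog]
      (List.product [0..<k] (List.product [0, 1] [1, 2])))"
    using assms by auto
  then show ?thesis unfolding prog_rules_def by (force simp del: set_product)
qed

lemma prog_rules_cases:
  assumes "(\<alpha>, \<beta>) \<in> set (prog_rules k prog)"
  obtains (hash) "\<alpha> = [1]" "\<beta> = [1]" | (digit) "\<alpha> = [2]" "\<beta> = [2]"
  | (init) "\<alpha> = [3]" "\<beta> = replicate k 1 @ [state 1 0 0]"
  | (instr) pc j m x where "1 \<le> pc" "pc < length prog" "\<alpha> = [state pc j m, x]"
      "\<beta> = out k pc (prog ! pc) j m x"
  using assms unfolding prog_rules_def by auto

lemma state_inject: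
  "pc \<noteq> 0 \<Longrightarrow> state pc j m = state pc' j' m' \<longleftrightarrow> pc = pc' \<and> j = j' \<and> m = m'"
  by (auto simp: state_def)

lemma prog_rules_hd:
  assumes "(\<alpha>, \<beta>) \<in> set (prog_rules k prog)"
  shows "\<exists>s \<alpha>'. \<alpha> = Suc s # \<alpha>'"
  using assms by (cases rule: prog_rules_cases) (simp_all add: state_def)

lemma deterministic_prog_rules: "deterministic (set (prog_rules k prog))"
  unfolding deterministic_def
proof (intro allI impI)
  fix \<alpha> \<beta> \<alpha>' \<beta>'
  assume 1: "(\<alpha>, \<beta>) \<in> set (prog_rules k prog)" and 2: "(\<alpha>', \<beta>') \<in> set (prog_rules k prog)"
  show "(\<alpha>, \<beta>) = (\<alpha>', \<beta>') \<or> clash \<alpha> \<alpha>'"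
  proof (cases "hd \<alpha> = hd \<alpha>'")
    case False
    then show ?thesis
      using prog_rules_hd[OF 1] prog_rules_hd[OF 2] by (auto intro: clash_Cons_neq)
  next
    case True
    from 1 2 show ?thesis
    proof (elim prog_rules_cases)
      fix pc j m x pc' j' m' x'
      assume *: "1 \<le> pc" "\<alpha> = [state pc j m, x]" "\<beta> = out k pc (prog ! pc) j m x"
        "\<alpha>' = [state pc' j' m', x']" "\<beta>' = out k pc' (prog ! pc') j' m' x'"
      then have "pc = pc' \<and> j = j' \<and> m = m'" using True state_inject[of pc] by auto
      then show ?thesis
        using * clash_Cons[OF clash_Cons_neq, of x x'] by (cases "x = x'") auto
    qed (use True in \<open>auto simp: state_def\<close>)
  qed
qed

lemma prog_rules_clash_exit:
  assumes "(\<alpha>, \<beta>) \<in> set (prog_rules k prog)"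
  shows "clash \<alpha> (state (length prog) j m # v)"
proof -
  have *: "state (length prog) j m \<notin> {1, 2, 3}" by (simp add: state_def)
  from assms show ?thesis
  proof (cases rule: prog_rules_cases)
    case (instr pc j' m' x)
    then have "state pc j' m' \<noteq> state (length prog) j m" using state_inject[of pc] by simp
    then show ?thesis unfolding instr(3) by (rule clash_Cons_neq)
  qed (use * in \<open>simp_all add: clash_Cons_neq\<close>)
qed

fun instr_of :: "cmd \<Rightarrow> nat \<Rightarrow> nat \<Rightarrow> instr list" where
  "instr_of (Add a r) p e = [ADD a r e]"
| "instr_of (Seq c d) p e = (let q = p + length (instr_of c p 0) in instr_of c p q @ instr_of d q e)"
| "instr_of (Loop r c) p e = DJZ r (p + 1) e # instr_of c (p + 1) p"

fun reg_bound :: "cmd \<Rightarrow> nat" where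
  "reg_bound (Add a r) = Suc r"
| "reg_bound (Seq c d) = max (reg_bound c) (reg_bound d)"
| "reg_bound (Loop r c) = max (Suc r) (reg_bound c)"

lemma length_instr_of: "length (instr_of c p e) = length (instr_of c p' e')"
proof (induction c arbitrary: p e p' e')
  case (Seq c d)
  show ?case
    unfolding instr_of.simps Let_def length_append by (intro arg_cong2[of _ _ _ _ "(+)"] Seq.IH)
next
  case (Loop r c)
  show ?case
    unfolding instr_of.simps list.size by (intro arg_cong2[of _ _ _ _ "(+)"] Loop.IH refl)
qed simp

definition regs :: "(nat \<Rightarrow> nat) \<Rightarrow> nat \<Rightarrow> nat \<Rightarrow> nat list"
  where "regs \<sigma> i j = concat (map (\<lambda>r. replicate (\<sigma> r) 2 @ [1]) [i..<j])"

lemma regs_data: "set (regs \<sigma> i j) \<subseteq> {1, 2}"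
  by (auto simp: regs_def)

lemma regs_empty: "regs \<sigma> i i = []"
  by (simp add: regs_def)

lemma regs_first: "i < j \<Longrightarrow> regs \<sigma> i j = replicate (\<sigma> i) 2 @ 1 # regs \<sigma> (Suc i) j"
  by (simp add: regs_def upt_conv_Cons)

lemma regs_last: "regs \<sigma> 0 (Suc j) = regs \<sigma> 0 j @ replicate (\<sigma> j) 2 @ [1]"
  by (simp add: regs_def)

lemma regs_zero: "(\<And>r. i \<le> r \<Longrightarrow> \<sigma> r = 0) \<Longrightarrow> regs \<sigma> i j = replicate (j - i) 1"
proof (induction j)
  case (Suc j)
  show ?case
  proof (cases "i \<le> j")
    case True
    then have "regs \<sigma> i (Suc j) = regs \<sigma> i j @ [1]" by (simp add: regs_def Suc.prems)
    then show ?thesis using Suc True by (simp add: Suc_diff_le replicate_append_same)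
  qed (simp add: regs_def)
qed (simp add: regs_def)

locale machine =
  fixes k :: nat and prog :: "instr list"
  assumes k_pos: "0 < k"
begin

abbreviation reach :: "nat list \<Rightarrow> nat list \<Rightarrow> bool"
  where "reach \<equiv> (post_step (set (prog_rules k prog)))\<^sup>*\<^sup>*"

lemma rule_step: "(\<alpha>, \<beta>) \<in> set (prog_rules k prog) \<Longrightarrow> reach (\<alpha> @ w) (w @ \<beta>)"
  by (rule r_into_rtranclp) (auto simp: post_step_def)

lemma rotate: "set u \<subseteq> {1, 2} \<Longrightarrow> reach (u @ v) (v @ u)"
proof (induction u arbitrary: v)
  case (Cons a u)
  then have "([a], [a]) \<in> set (prog_rules k prog)" by (auto simp: prog_rules_def)
  from rule_step[OF this, of "u @ v"] have "reach ((a # u) @ v) (u @ v @ [a])" by simp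
  also have "reach (u @ v @ [a]) ((v @ [a]) @ u)"
    by (rule Cons.IH) (use Cons.prems in simp)
  finally show ?case by simp
qed simp

lemma instr_step:
  assumes "1 \<le> pc" "pc < length prog" "j < k" "m \<le> 1" "x = 1 \<or> x = 2"
    and out: "out k pc (prog ! pc) j m x = \<beta> @ [q]" "set \<beta> \<subseteq> {1, 2}" and w: "set w \<subseteq> {1, 2}"
  shows "reach (state pc j m # x # w) (q # w @ \<beta>)"
proof -
  have "([state pc j m, x], \<beta> @ [q]) \<in> set (prog_rules k prog)"
    using instr_in_prog_rules[OF assms(1-5)] out(1) by simp
  from rule_step[OF this, of w]
  have "reach (state pc j m # x # w) ((w @ \<beta>) @ [q])" by simp
  also have "reach ((w @ \<beta>) @ [q]) ([q] @ w @ \<beta>)"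
    by (rule rotate) (use out(2) w in auto)
  finally show ?thesis by simp
qed

lemma copy_digits:
  assumes "1 \<le> pc" "pc < length prog" "j < k" "m \<le> 1"
    and "out k pc (prog ! pc) j m 2 = [2, state pc j m]" and "set w \<subseteq> {1, 2}"
  shows "reach (state pc j m # replicate a 2 @ w) (state pc j m # w @ replicate a 2)"
  using assms(6)
proof (induction a arbitrary: w)
  case (Suc a)
  have "reach (state pc j m # 2 # (replicate a 2 @ w)) (state pc j m # replicate a 2 @ w @ [2])"
    using instr_step[of pc j m 2 "[2]" "state pc j m" "replicate a 2 @ w"] assms Suc.prems
    by (auto simp: set_replicate_conv_if)
  also have "reach (state pc j m # replicate a 2 @ w @ [2]) (state pc j m # (w @ [2]) @ replicate a 2)"
    by (rule Suc.IH) (use Suc.prems in auto)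
  finally show ?case by simp
qed simp

lemma pass_ADD:
  fixes \<sigma> :: "nat \<Rightarrow> nat"
  assumes pc: "1 \<le> pc" "pc < length prog" and instr: "prog ! pc = ADD a r l" and "j < k"
  defines "\<sigma>' \<equiv> \<sigma>(r := \<sigma> r + a)"
  shows "reach (state pc j 0 # regs \<sigma> j k @ regs \<sigma>' 0 j) (state l 0 0 # regs \<sigma>' 0 k)"
  using \<open>j < k\<close>
proof (induction "k - j" arbitrary: j)
  case (Suc n)
  let ?u = "if j = r then replicate a 2 else [] :: nat list"
  let ?q = "if Suc j < k then state pc (Suc j) 0 else state l 0 0"
  let ?w = "regs \<sigma> (Suc j) k @ regs \<sigma>' 0 j"
  have w: "set ?w \<subseteq> {1, 2}" using regs_data by auto
  have "reach (state pc j 0 # replicate (\<sigma> j) 2 @ 1 # ?w) (state pc j 0 # 1 # (?w @ replicate (\<sigma> j) 2))"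
    using copy_digits[of pc j 0 "1 # ?w" "\<sigma> j"] pc Suc.prems w instr by simp
  moreover have "reach (state pc j 0 # 1 # (?w @ replicate (\<sigma> j) 2)) (?q # (?w @ replicate (\<sigma> j) 2) @ ?u @ [1])"
  proof (rule instr_step[OF pc Suc.prems])
    show "out k pc (prog ! pc) j 0 1 = (?u @ [1]) @ [?q]" by (simp add: instr)
  qed (use w in auto)
  moreover have "(?w @ replicate (\<sigma> j) 2) @ ?u @ [1] = regs \<sigma> (Suc j) k @ regs \<sigma>' 0 (Suc j)"
    by (simp add: regs_last \<sigma>'_def replicate_add)
  ultimately have 1: "reach (state pc j 0 # regs \<sigma> j k @ regs \<sigma>' 0 j)
      (?q # regs \<sigma> (Suc j) k @ regs \<sigma>' 0 (Suc j))"
    using regs_first[OF Suc.prems, of \<sigma>] by (simp only: append_assoc append_Cons)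
  show ?case
  proof (cases "Suc j < k")
    case True
    then have "reach (state pc (Suc j) 0 # regs \<sigma> (Suc j) k @ regs \<sigma>' 0 (Suc j)) (state l 0 0 # regs \<sigma>' 0 k)"
      using Suc.hyps(2) by (intro Suc.hyps(1)) simp_all
    then show ?thesis using 1 unfolding if_P[OF True] by (rule rtranclp_trans[rotated])
  next
    case False
    then have "k = Suc j" using Suc.prems by simp
    then show ?thesis using 1 by (simp add: regs_empty)
  qed
qed simp

lemma pass_DJZ:
  fixes \<sigma> :: "nat \<Rightarrow> nat"
  assumes pc: "1 \<le> pc" "pc < length prog" and instr: "prog ! pc = DJZ r l l'" and "j < k" and r: "r < k"
  defines "\<sigma>' \<equiv> \<sigma>(r := \<sigma> r - 1)" and "mode \<equiv> \<lambda>j. if j \<le> r \<or> \<sigma> r = 0 then 0 else 1"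
  shows "reach (state pc j (mode j) # regs \<sigma> j k @ regs \<sigma>' 0 j)
    (state (if \<sigma> r = 0 then l' else l) 0 0 # regs \<sigma>' 0 k)"
  using \<open>j < k\<close>
proof (induction "k - j" arbitrary: j)
  case (Suc n)
  let ?m = "mode (Suc j)"
  let ?q = "if Suc j < k then state pc (Suc j) ?m else state (if ?m = 0 then l' else l) 0 0"
  let ?w = "regs \<sigma> (Suc j) k @ regs \<sigma>' 0 j"
  have w: "set ?w \<subseteq> {1, 2}" using regs_data by auto
  have m: "mode i \<le> 1" for i by (simp add: mode_def)
  have hash: "reach (state pc j ?m # 1 # (?w @ replicate (\<sigma>' j) 2)) (?q # (?w @ replicate (\<sigma>' j) 2) @ [1])"
  proof (rule instr_step[OF pc Suc.prems m])
    show "out k pc (prog ! pc) j ?m 1 = [1] @ [?q]" by (simp add: instr)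
  qed (use w in auto)
  have "reach (state pc j (mode j) # replicate (\<sigma> j) 2 @ 1 # ?w) (state pc j ?m # 1 # (?w @ replicate (\<sigma>' j) 2))"
  proof (cases "j = r \<and> \<sigma> r \<noteq> 0")
    case True
    then obtain b where b: "\<sigma> j = Suc b" by (cases "\<sigma> j") simp_all
    have modes: "mode j = 0" "?m = 1" using True by (auto simp: mode_def)
    have "reach (state pc j 0 # 2 # (replicate b 2 @ 1 # ?w)) (state pc j 1 # replicate b 2 @ 1 # ?w)"
      using instr_step[OF pc Suc.prems, of 0 2 "[]" "state pc j 1" "replicate b 2 @ 1 # ?w"] w instr True
      by (simp add: set_replicate_conv_if)
    also have "reach (state pc j 1 # replicate b 2 @ 1 # ?w) (state pc j 1 # (1 # ?w) @ replicate b 2)"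
      using copy_digits[OF pc Suc.prems, of 1 "1 # ?w" b] w instr by simp
    finally show ?thesis using True b modes by (simp add: \<sigma>'_def)
  next
    case False
    then have "mode j = ?m" "\<sigma>' j = \<sigma> j" by (cases "j = r"; simp add: mode_def \<sigma>'_def; fail)+
    moreover have "reach (state pc j ?m # replicate (\<sigma> j) 2 @ 1 # ?w)
        (state pc j ?m # (1 # ?w) @ replicate (\<sigma> j) 2)"
    proof (cases "j = r")
      case True
      then show ?thesis using False by simp
    next
      case False
      then show ?thesis
        using copy_digits[OF pc Suc.prems m, of "Suc j" "1 # ?w" "\<sigma> j"] w instr by simp
    qed
    ultimately show ?thesis by simp
  qed
  moreover note hash
  moreover have "(?w @ replicate (\<sigma>' j) 2) @ [1] = regs \<sigma> (Suc j) k @ regs \<sigma>' 0 (Suc j)"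
    by (simp add: regs_last)
  ultimately have 1: "reach (state pc j (mode j) # regs \<sigma> j k @ regs \<sigma>' 0 j)
      (?q # regs \<sigma> (Suc j) k @ regs \<sigma>' 0 (Suc j))"
    using regs_first[OF Suc.prems, of \<sigma>] by (simp only: append_assoc append_Cons)
  show ?case
  proof (cases "Suc j < k")
    case True
    then have "reach (state pc (Suc j) ?m # regs \<sigma> (Suc j) k @ regs \<sigma>' 0 (Suc j))
        (state (if \<sigma> r = 0 then l' else l) 0 0 # regs \<sigma>' 0 k)"
      using Suc.hyps(2) by (intro Suc.hyps(1)) simp_all
    then show ?thesis using 1 unfolding if_P[OF True] by (rule rtranclp_trans[rotated])
  next
    case False
    then have k: "k = Suc j" using Suc.prems by simp
    then have "?m = 0 \<longleftrightarrow> \<sigma> r = 0" using r by (simp add: mode_def)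
    then show ?thesis using 1 k by (simp add: regs_empty)
  qed
qed simp

definition conf :: "nat \<Rightarrow> (nat \<Rightarrow> nat) \<Rightarrow> nat list"
  where "conf pc \<sigma> = state pc 0 0 # regs \<sigma> 0 k"

lemma reach_ADD:
  assumes "1 \<le> pc" "pc < length prog" "prog ! pc = ADD a r l"
  shows "reach (conf pc \<sigma>) (conf l (\<sigma>(r := \<sigma> r + a)))"
  using pass_ADD[OF assms k_pos, of \<sigma>] by (simp add: conf_def regs_empty)

lemma reach_DJZ:
  assumes "1 \<le> pc" "pc < length prog" "prog ! pc = DJZ r l l'" "r < k"
  shows "reach (conf pc \<sigma>) (conf (if \<sigma> r = 0 then l' else l) (\<sigma>(r := \<sigma> r - 1)))"
  using pass_DJZ[OF assms(1-3) k_pos assms(4), of \<sigma>] by (simp add: conf_def regs_empty)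

lemma reach_exec:
  assumes "exec c \<sigma> \<sigma>'" and "reg_bound c \<le> k" and "prog = pre @ instr_of c p e @ post"
    and "length pre = p" and "1 \<le> p"
  shows "reach (conf p \<sigma>) (conf e \<sigma>')"
  using assms
proof (induction arbitrary: pre p e post rule: exec.induct)
  case (exec_Add a r \<sigma>)
  then show ?case by (intro reach_ADD) auto
next
  case (exec_Seq c \<sigma> \<sigma>' d \<sigma>'')
  let ?q = "p + length (instr_of c p 0)"
  have prog: "prog = pre @ instr_of c p ?q @ instr_of d ?q e @ post"
    using exec_Seq.prems(2) by (simp add: Let_def)
  have "reach (conf p \<sigma>) (conf ?q \<sigma>')"
    using exec_Seq.prems prog by (intro exec_Seq.IH(1)) auto
  also have "reach (conf ?q \<sigma>') (conf e \<sigma>'')"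
  proof (rule exec_Seq.IH(2))
    show "prog = (pre @ instr_of c p ?q) @ instr_of d ?q e @ post" using prog by simp
    show "length (pre @ instr_of c p ?q) = ?q"
      using exec_Seq.prems(3) length_instr_of[of c p ?q p 0] by simp
  qed (use exec_Seq.prems in auto)
  finally show ?case .
next
  case (exec_Loop_0 \<sigma> r c)
  have "reach (conf p \<sigma>) (conf (if \<sigma> r = 0 then e else p + 1) (\<sigma>(r := \<sigma> r - 1)))"
    using exec_Loop_0.prems by (intro reach_DJZ) auto
  moreover have "\<sigma>(r := \<sigma> r - 1) = \<sigma>" using exec_Loop_0.hyps by auto
  ultimately show ?case using exec_Loop_0.hyps by simp
next
  case (exec_Loop_Suc \<sigma> r a c \<sigma>' \<sigma>'')
  have "reach (conf p \<sigma>) (conf (if \<sigma> r = 0 then e else p + 1) (\<sigma>(r := \<sigma> r - 1)))"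
    using exec_Loop_Suc.prems by (intro reach_DJZ) auto
  then have "reach (conf p \<sigma>) (conf (p + 1) (\<sigma>(r := a)))" using exec_Loop_Suc.hyps(1) by simp
  also have "reach (conf (p + 1) (\<sigma>(r := a))) (conf p \<sigma>')"
  proof (rule exec_Loop_Suc.IH(1))
    show "prog = (pre @ [DJZ r (p + 1) e]) @ instr_of c (p + 1) p @ post"
      using exec_Loop_Suc.prems(2) by simp
  qed (use exec_Loop_Suc.prems in auto)
  also have "reach (conf p \<sigma>') (conf e \<sigma>'')"
    using exec_Loop_Suc.prems by (rule exec_Loop_Suc.IH(2))
  finally show ?case .
qed

lemma reach_init: "reach (3 # replicate n 2) (conf 1 ((\<lambda>_. 0)(0 := n)))"
proof -
  have "([3], replicate k 1 @ [state 1 0 0]) \<in> set (prog_rules k prog)"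
    by (simp add: prog_rules_def)
  from rule_step[OF this, of "replicate n 2"]
  have "reach (3 # replicate n 2) ((replicate n 2 @ replicate k 1) @ [state 1 0 0])" by simp
  also have "reach \<dots> ([state 1 0 0] @ replicate n 2 @ replicate k 1)"
    by (rule rotate) auto
  finally have "reach (3 # replicate n 2) ([state 1 0 0] @ replicate n 2 @ replicate k 1)" .
  moreover have "replicate n 2 @ replicate k 1 = regs ((\<lambda>_. 0)(0 := n)) 0 k"
    unfolding regs_first[OF k_pos] using k_pos
    by (simp add: regs_zero replicate_Suc[symmetric] del: replicate_Suc)
  ultimately show ?thesis by (simp add: conf_def)
qed

end

lemma rec_eval_post_system:
  obtains P where "deterministic (set P)" "\<And>\<alpha> \<beta>. (\<alpha>, \<beta>) \<in> set P \<Longrightarrow> \<exists>\<alpha>'. \<alpha> = False # \<alpha>'"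
    "\<And>n. rec_eval p [n] 0 \<Longrightarrow>
      \<exists>v. (post_step (set P))\<^sup>*\<^sup>* (enc (3 # replicate n 2)) (False # v)
        \<and> (\<forall>\<alpha> \<beta>. (\<alpha>, \<beta>) \<in> set P \<longrightarrow> clash \<alpha> (False # v))"
    "\<And>n. rec_eval p [n] 1 \<Longrightarrow>
      \<exists>v. (post_step (set P))\<^sup>*\<^sup>* (enc (3 # replicate n 2)) (True # v)"
proof -
  define c where "c = compile p [0] 1"
  define k where "k = reg_bound c + 2"
  define e where "e = Suc (length (instr_of c 1 0))"
  define prog where "prog = [ADD 0 0 0] @ instr_of c 1 e @ [DJZ 1 0 (Suc e)]"
  define P where "P = prog_rules k prog"
  interpret machine k prog by standard (simp add: k_def)
  have len: "length prog = Suc e" "prog ! e = DJZ 1 0 (Suc e)"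
    using length_instr_of[of c 1 e 1 0] by (simp_all add: prog_def e_def nth_append)
  have run: "\<exists>w. reach (3 # replicate n 2) (state (if y = 0 then Suc e else 0) 0 0 # w)"
    if y: "rec_eval p [n] y" for n y
  proof -
    obtain \<sigma>' where \<sigma>': "exec c ((\<lambda>_. 0)(0 := n)) \<sigma>'" "\<sigma>' 1 = y"
      using implementsD[OF implements_all _ y, of "[0]" 1 "(\<lambda>_. 0)(0 := n)"] unfolding c_def by auto
    have "reach (3 # replicate n 2) (conf 1 ((\<lambda>_. 0)(0 := n)))" by (rule reach_init)
    also have "reach \<dots> (conf e \<sigma>')"
      by (rule reach_exec[OF \<sigma>'(1) _ prog_def]) (simp_all add: k_def)
    also have "reach \<dots> (conf (if \<sigma>' 1 = 0 then Suc e else 0) (\<sigma>'(1 := \<sigma>' 1 - 1)))"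
      by (rule reach_DJZ) (use len in \<open>simp_all add: e_def k_def\<close>)
    finally show ?thesis using \<sigma>'(2) unfolding conf_def by blast
  qed
  have "deterministic (set (encode_rules P))"
    by (simp add: P_def deterministic_encode_rules deterministic_prog_rules)
  moreover have "\<exists>\<alpha>'. \<alpha> = False # \<alpha>'" if "(\<alpha>, \<beta>) \<in> set (encode_rules P)" for \<alpha> \<beta>
    using that prog_rules_hd unfolding P_def encode_rules_def by (fastforce simp: enc_Cons sym_code_def)
  moreover have "\<exists>v. (post_step (set (encode_rules P)))\<^sup>*\<^sup>* (enc (3 # replicate n 2)) (False # v)
      \<and> (\<forall>\<alpha> \<beta>. (\<alpha>, \<beta>) \<in> set (encode_rules P) \<longrightarrow> clash \<alpha> (False # v))" if "rec_eval p [n] 0" for n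
  proof -
    obtain w where "reach (3 # replicate n 2) (state (length prog) 0 0 # w)"
      using run[OF \<open>rec_eval p [n] 0\<close>] len by auto
    from post_steps_enc[OF this]
    have 1: "(post_step (set (encode_rules P)))\<^sup>*\<^sup>* (enc (3 # replicate n 2)) (enc (state (length prog) 0 0 # w))"
      by (simp add: P_def)
    have 2: "\<forall>\<alpha> \<beta>. (\<alpha>, \<beta>) \<in> set (encode_rules P) \<longrightarrow> clash \<alpha> (enc (state (length prog) 0 0 # w))"
      unfolding P_def encode_rules_def by (auto intro: clash_enc dest: prog_rules_clash_exit)
    obtain s where "state (length prog) 0 0 = Suc s"
      using len(1) by (simp add: state_def)
    then have "enc (state (length prog) 0 0 # w) = False # sym_code s @ enc w"
      by (simp add: enc_Cons sym_code_def)
    with 1 2 show ?thesis by auto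
  qed
  moreover have "\<exists>v. (post_step (set (encode_rules P)))\<^sup>*\<^sup>* (enc (3 # replicate n 2)) (True # v)"
    if "rec_eval p [n] 1" for n
  proof -
    obtain w where "reach (3 # replicate n 2) (0 # w)"
      using run[OF \<open>rec_eval p [n] 1\<close>] by (auto simp: state_def)
    from post_steps_enc[OF this] show ?thesis
      by (auto simp: P_def enc_Cons sym_code_def)
  qed
  ultimately show thesis by (rule that)
qed

section \<open>Computing the codes of the terms\<close>

fun rconst :: "nat \<Rightarrow> recf" where
  "rconst 0 = RZero"
| "rconst (Suc c) = RComp RSuc [rconst c]"

definition radd :: recf
  where "radd = RPrim (RProj 0) (RComp RSuc [RProj 1])"

definition rtriangle :: recf
  where "rtriangle = RPrim RZero (RComp radd [RComp RSuc [RProj 0], RProj 1])"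

definition rpair :: "recf \<Rightarrow> recf \<Rightarrow> recf"
  where "rpair p q = RComp (RComp radd [RComp rtriangle [radd], RProj 0]) [p, q]"

lemma rec_eval_proj: "i < length xs \<Longrightarrow> y = xs ! i \<Longrightarrow> rec_eval (RProj i) xs y"
  by (simp add: rec_proj)

lemma rec_eval_comp1: "rec_eval p xs a \<Longrightarrow> rec_eval f [a] z \<Longrightarrow> rec_eval (RComp f [p]) xs z"
  by (rule rec_comp[of _ _ "[a]"]) simp_all

lemma rec_eval_comp2:
  "rec_eval p xs a \<Longrightarrow> rec_eval q xs b \<Longrightarrow> rec_eval f [a, b] z \<Longrightarrow> rec_eval (RComp f [p, q]) xs z"
  by (rule rec_comp[of _ _ "[a, b]"]) simp_all

lemma rec_eval_const: "rec_eval (rconst c) xs c"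
  by (induction c) (auto intro: rec_zero rec_eval_comp1 rec_suc)

lemma rec_eval_add: "rec_eval radd (m # n # xs) (m + n)"
  unfolding radd_def
proof (induction m)
  case 0
  show ?case by (rule rec_prim_0) (simp add: rec_eval_proj)
next
  case (Suc m)
  show ?case unfolding add_Suc
    by (rule rec_prim_Suc[OF Suc], rule rec_eval_comp1[OF _ rec_suc]) (simp add: rec_eval_proj)
qed

lemma rec_eval_triangle: "rec_eval rtriangle (n # xs) (triangle n)"
  unfolding rtriangle_def
proof (induction n)
  case 0
  show ?case unfolding triangle_0 by (intro rec_prim_0 rec_zero)
next
  case (Suc n)
  have "rec_eval (RComp radd [RComp RSuc [RProj 0], RProj 1]) (n # triangle n # xs) (Suc n + triangle n)"
  proof (rule rec_eval_comp2[OF _ _ rec_eval_add])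
    show "rec_eval (RComp RSuc [RProj 0]) (n # triangle n # xs) (Suc n)"
      by (rule rec_eval_comp1[OF _ rec_suc]) (simp add: rec_eval_proj)
  qed (simp add: rec_eval_proj)
  from rec_prim_Suc[OF Suc this] show ?case by (simp add: add.commute)
qed

lemma rec_eval_pair:
  assumes "rec_eval p xs a" "rec_eval q xs b"
  shows "rec_eval (rpair p q) xs (prod_encode (a, b))"
  unfolding rpair_def prod_encode_def prod.case
  by (intro rec_eval_comp2[OF assms] rec_eval_comp2[OF _ _ rec_eval_add]
      rec_eval_comp1[OF rec_eval_add rec_eval_triangle]) (simp add: rec_eval_proj)

definition rplus :: "recf \<Rightarrow> recf \<Rightarrow> recf"
  where "rplus p q = rpair (rconst 3) (rpair p q)"

definition rtimes :: "recf \<Rightarrow> recf \<Rightarrow> recf"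
  where "rtimes p q = rpair (rconst 4) (rpair p q)"

definition rstar :: "recf \<Rightarrow> recf"
  where "rstar p = rpair (rconst 5) p"

lemma rec_eval_trm_code:
  "rec_eval p xs (trm_code s) \<Longrightarrow> rec_eval q xs (trm_code t) \<Longrightarrow> rec_eval (rplus p q) xs (trm_code (Plus s t))"
  "rec_eval p xs (trm_code s) \<Longrightarrow> rec_eval q xs (trm_code t) \<Longrightarrow> rec_eval (rtimes p q) xs (trm_code (Times s t))"
  "rec_eval p xs (trm_code s) \<Longrightarrow> rec_eval (rstar p) xs (trm_code (Star s))"
  unfolding rplus_def rtimes_def rstar_def trm_code.simps
  by (intro rec_eval_pair rec_eval_const; assumption)+

fun digits_trm :: "nat \<Rightarrow> (sigma + sigma) trm \<Rightarrow> (sigma + sigma) trm" where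
  "digits_trm 0 \<rho> = Star \<rho>"
| "digits_trm (Suc n) \<rho> = Times (word lgen (sym_code 2)) (digits_trm n \<rho>)"

definition input_trm :: "nat \<Rightarrow> (sigma + sigma) trm \<Rightarrow> (sigma + sigma) trm"
  where "input_trm n \<rho> = Times (word lgen (sym_code 3)) (digits_trm n \<rho>)"

lemma pka_of_input_trm: "pka_of (input_trm n \<rho>) = pka_of (run_trm (enc (3 # replicate n 2)) \<rho>)"
proof -
  have "pka_of (digits_trm n \<rho>) = pka_of (word lgen (enc (replicate n 2))) * pka_of (Star \<rho>)"
    by (induction n) (simp_all add: enc_Cons pka_of_word_append mult.assoc
        times_free_pka.abs_eq[symmetric] one_free_pka.abs_eq[symmetric] enc_def)
  then show ?thesis
    by (simp add: input_trm_def run_trm_def enc_Cons pka_of_word_append mult.assoc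
        times_free_pka.abs_eq[symmetric])
qed

definition rinput :: recf
  where "rinput = rtimes (rconst (trm_code (word lgen (sym_code 3))))
    (RComp (RPrim (rstar (RProj 0)) (rtimes (rconst (trm_code (word lgen (sym_code 2)))) (RProj 1)))
      [RProj 0, RProj 0])"

lemma rec_eval_input: "rec_eval rinput [trm_code \<rho>] (trm_code (input_trm (trm_code \<rho>) \<rho>))"
proof -
  let ?d = "RPrim (rstar (RProj 0)) (rtimes (rconst (trm_code (word lgen (sym_code 2)))) (RProj 1))"
  have "rec_eval ?d [n, trm_code \<rho>] (trm_code (digits_trm n \<rho>))" for n
  proof (induction n)
    case 0
    show ?case unfolding digits_trm.simps
      by (intro rec_prim_0 rec_eval_trm_code rec_eval_proj) simp_all
  next
    case (Suc n)
    show ?case unfolding digits_trm.simps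
      by (rule rec_prim_Suc[OF Suc], intro rec_eval_trm_code rec_eval_const rec_eval_proj) simp_all
  qed
  then show ?thesis
    unfolding rinput_def input_trm_def
    by (intro rec_eval_trm_code rec_eval_const rec_eval_comp2 rec_eval_proj) simp_all
qed

definition rharmless :: recf
  where "rharmless = rplus
    (rconst (trm_code (Times (Star match_trm) (Times (lgen False) (any_trm lgen)))))
    (rtimes (rconst (trm_code (Star match_trm))) (rtimes (rconst (trm_code clash_trm))
      (rtimes (rconst (trm_code (any_trm lgen))) (rtimes (rconst (trm_code (any_trm rgen)))
        (rstar (RProj 0))))))"

lemma rec_eval_harmless: "rec_eval rharmless [trm_code \<rho>] (trm_code (harmless_trm \<rho>))"
proof -
  have "rec_eval (RProj 0) [trm_code \<rho>] (trm_code \<rho>)" by (simp add: rec_eval_proj)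
  then show ?thesis
    unfolding rharmless_def harmless_trm_def
    by (intro rec_eval_trm_code(1)[OF rec_eval_const] rec_eval_trm_code(2)[OF rec_eval_const]
        rec_eval_trm_code(3))
qed

section \<open>Undecidability\<close>

lemma pka_coding_trm_code: "pka_coding (trm_code t) = Some (pka_of t)"
  using trm_of_code_eq_Some_iff[of "trm_code t" t] by (simp add: pka_coding_def)

lemma undecidable_equality:
  fixes h :: "'x \<Rightarrow> (sigma + sigma) lang"
  assumes comp: "computable_map pka_coding \<nu> l'" and h: "\<And>t. h (l' t) = lang_interp t"
  shows "\<not> decidable_equality \<nu>"
proof
  assume "decidable_equality \<nu>"
  then obtain pd where pd: "\<And>m n. m \<in> dom \<nu> \<Longrightarrow> n \<in> dom \<nu> \<Longrightarrow>
      rec_eval pd [m, n] (if \<nu> m = \<nu> n then 1 else 0)"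
    unfolding decidable_equality_def by blast
  obtain pl where pl: "\<And>t. \<exists>m. rec_eval pl [trm_code t] m \<and> \<nu> m = Some (l' (pka_of t))"
    using comp pka_coding_trm_code unfolding computable_map_def by blast
  let ?lhs = "\<lambda>\<rho>. Plus (input_trm (trm_code \<rho>) \<rho>) (harmless_trm \<rho>)"
  define p where "p = RComp pd [RComp pl [rplus rinput rharmless], RComp pl [rharmless]]"
  have p: "rec_eval p [trm_code \<rho>]
      (if l' (pka_of (?lhs \<rho>)) = l' (pka_of (harmless_trm \<rho>)) then 1 else 0)" for \<rho>
  proof -
    obtain m where m: "rec_eval pl [trm_code (?lhs \<rho>)] m" "\<nu> m = Some (l' (pka_of (?lhs \<rho>)))"
      using pl by blast
    obtain n where n: "rec_eval pl [trm_code (harmless_trm \<rho>)] n"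
      "\<nu> n = Some (l' (pka_of (harmless_trm \<rho>)))"
      using pl by blast
    have "rec_eval pd [m, n] (if l' (pka_of (?lhs \<rho>)) = l' (pka_of (harmless_trm \<rho>)) then 1 else 0)"
      using pd[of m n] m(2) n(2) by (simp add: domI split: if_splits)
    then show ?thesis
      unfolding p_def
      by (rule rec_eval_comp2[OF rec_eval_comp1[OF rec_eval_trm_code(1)[OF rec_eval_input rec_eval_harmless] m(1)]
            rec_eval_comp1[OF rec_eval_harmless n(1)]])
  qed
  obtain P where det: "deterministic (set P)"
    and starts: "\<And>\<alpha> \<beta>. (\<alpha>, \<beta>) \<in> set P \<Longrightarrow> \<exists>\<alpha>'. \<alpha> = False # \<alpha>'"
    and halts: "\<And>n. rec_eval p [n] 0 \<Longrightarrow>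
      \<exists>v. (post_step (set P))\<^sup>*\<^sup>* (enc (3 # replicate n 2)) (False # v)
        \<and> (\<forall>\<alpha> \<beta>. (\<alpha>, \<beta>) \<in> set P \<longrightarrow> clash \<alpha> (False # v))"
    and rejects: "\<And>n. rec_eval p [n] 1 \<Longrightarrow>
      \<exists>v. (post_step (set P))\<^sup>*\<^sup>* (enc (3 # replicate n 2)) (True # v)"
    using rec_eval_post_system[of p] by blast
  define \<rho> where "\<rho> = rules_trm P"
  let ?run = "run_trm (enc (3 # replicate (trm_code \<rho>) 2)) \<rho>"
  have lhs: "pka_of (?lhs \<rho>) = pka_of (Plus ?run (harmless_trm \<rho>))"
    by (simp add: plus_free_pka.abs_eq[symmetric] pka_of_input_trm)
  show False
  proof (cases "l' (pka_of (?lhs \<rho>)) = l' (pka_of (harmless_trm \<rho>))")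
    case True
    then have "rec_eval p [trm_code \<rho>] 1" using p[of \<rho>] by simp
    then obtain v where "(post_step (set P))\<^sup>*\<^sup>* (enc (3 # replicate (trm_code \<rho>) 2)) (True # v)"
      using rejects by blast
    from rejecting_run_language[OF this]
    have "lang_interp (pka_of (?lhs \<rho>)) \<noteq> lang_interp (pka_of (harmless_trm \<rho>))"
      unfolding lhs unfolding lang_interp.abs_eq \<rho>_def .
    then show False using True h by metis
  next
    case False
    then have "rec_eval p [trm_code \<rho>] 0" using p[of \<rho>] by simp
    then obtain v where v: "(post_step (set P))\<^sup>*\<^sup>* (enc (3 # replicate (trm_code \<rho>) 2)) (False # v)"
      "\<And>\<alpha> \<beta>. (\<alpha>, \<beta>) \<in> set P \<Longrightarrow> clash \<alpha> (False # v)"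
      using halts by blast
    from halting_run_below_harmless[OF det starts v]
    have "pka_of (?lhs \<rho>) = pka_of (harmless_trm \<rho>)"
      unfolding lhs by (simp add: below_def plus_free_pka.abs_eq[symmetric] \<rho>_def)
    then show False using False by simp
  qed
qed

lemma trm_lang_ka_eq: "ka_eq s t \<Longrightarrow> trm_lang s = trm_lang t"
  by (induction rule: ka_eq.induct) (simp_all add: trm_lang_pka_eq star_induct_left star_induct_right)

lift_definition ka_of_pka :: "'y::commutable free_pka \<Rightarrow> 'y free_ka" is "\<lambda>t. t"
  by (rule ka_pka)

lift_definition lang_of_ka :: "'y::commutable free_ka \<Rightarrow> 'y lang" is trm_lang
  by (rule trm_lang_ka_eq)

lemma computable_mapI_trm_code:
  assumes "\<And>t. \<nu> (trm_code t) = Some (f (pka_of t))"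
  shows "computable_map pka_coding \<nu> f"
  unfolding computable_map_def
proof (intro exI[of _ "RProj 0"] allI impI)
  fix n x assume "pka_coding n = Some x"
  then obtain t where "n = trm_code t" "x = pka_of t"
    by (auto simp: pka_coding_def trm_of_code_eq_Some_iff)
  then show "\<exists>m. rec_eval (RProj 0) [n] m \<and> \<nu> m = Some (f x)"
    using assms by (auto intro: rec_eval_proj)
qed

theorem mainTheorem1:
  shows "(\<forall>(X :: 'x set) (\<nu> :: nat \<rightharpoonup> 'x)
            (h :: 'x \<Rightarrow> (sigma + sigma) lang) (l' :: (sigma + sigma) free_pka \<Rightarrow> 'x).
            ran \<nu> = X \<longrightarrow>
            (\<forall>t. l' t \<in> X) \<longrightarrow>
            computable_map pka_coding \<nu> l' \<longrightarrow>
            (\<forall>t. h (l' t) = lang_interp t) \<longrightarrow>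
            \<not> decidable_equality \<nu>)
       \<and> \<not> decidable_equality pka_coding
       \<and> \<not> decidable_equality ka_coding
       \<and> \<not> decidable_equality lang_coding"
proof (intro conjI allI impI)
  fix X and \<nu> :: "nat \<rightharpoonup> 'x" and h :: "'x \<Rightarrow> (sigma + sigma) lang" and l'
  assume "computable_map pka_coding \<nu> l'" "\<forall>t. h (l' t) = lang_interp t"
  then show "\<not> decidable_equality \<nu>" using undecidable_equality by metis
next
  have "computable_map pka_coding pka_coding (\<lambda>x. x)"
    by (rule computable_mapI_trm_code) (rule pka_coding_trm_code)
  then show "\<not> decidable_equality pka_coding" by (rule undecidable_equality) (rule refl)
next
  have code: "trm_of_code (trm_code t) = Some t" for t
    by (simp add: trm_of_code_eq_Some_iff)
  have "computable_map pka_coding ka_coding ka_of_pka"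
    by (rule computable_mapI_trm_code) (simp add: ka_coding_def code ka_of_pka.abs_eq)
  moreover have "lang_of_ka (ka_of_pka t) = lang_interp t" for t :: "(sigma + sigma) free_pka"
    by transfer (rule refl)
  ultimately show "\<not> decidable_equality ka_coding" by (rule undecidable_equality)
  have "computable_map pka_coding lang_coding lang_interp"
    by (rule computable_mapI_trm_code) (simp add: lang_coding_def code)
  then show "\<not> decidable_equality lang_coding" by (rule undecidable_equality) (rule refl)
qed

end
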